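(* Let $\lambda$ be a strict partition of length $\ell$. (a) Suppose that $\ell$ is even and $\lambda=\delta_{\ell-1}+\mu$ for some partition $\mu$. Then $$P_\lambda(X\,|\,t)=\sum_{\nu\subset\mu}P_{\delta_{\ell-1}+\nu}(X)\,S^\lambda_{\mu/\nu}(e(-t)).$$ (b) Suppose that $\ell$ is odd and $\lambda=\delta_\ell+\mu$ for some partition $\mu$. Then $$P_\lambda(X\,|\,t)=\sum_{\nu\subset\mu}P_{\delta_\ell+\nu}(X)\,S^\lambda_{\mu/\nu}(e(-t)).$$ In both cases the sum is over all partitions $\nu$ contained in $\mu$.
   Context: $X=(x_1,x_2,\ldots)$ and $t=(t_1,t_2,\ldots)$ are sequences of independent variables; $-t=(-t_1,-t_2,\ldots)$. A partition is strict if its nonzero parts are distinct; its length is its number of nonzero parts. $\delta_r=(r,r-1,\ldots,1)$ (empty for $r\leq0$); sums of partitions are componentwise. Put $(x\,|\,t)^r=(x-t_1)\cdots(x-t_r)$. For a strict partition $\lambda$ of length $\ell$ and $n\geq\ell$, Ivanov's double Schur $P$-function is $$P_\lambda(x_1,\ldots,x_n\,|\,t)=\frac1{(n-\ell)!}\sum_{\varpi\in S_n}\varpi\left(\prod_{i=1}^\ell(x_i\,|\,t)^{\lambda_i}\prod_{i\leq\ell,\ i<j\leq n}\frac{x_i+x_j}{x_i-x_j}\right),$$ where $S_n$ permutes $x_1,\ldots,x_n$. $P_\lambda(X\,|\,t)$ denotes the projective limit of $P_\lambda(x_1,\ldots,x_{2m}\,|\,t)$ as $m\to\infty$ (along even numbers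 of variables), and $P_\lambda(X)=P_\lambda(X\,|\,0)$ is the Schur $P$-function. The flagged Schur polynomial here is $$S^\lambda_{\mu/\nu}(e(-t))=\det\bigl(e^{\lambda_i}_{\mu_i-\nu_j+j-i}(-t)\bigr)_{1\leq i,j\leq\ell},$$ where $e^r_p(-t)=e_p(-t_1,\ldots,-t_r)$ is the elementary symmetric polynomial ($e_0=1$, $e_p=0$ for $p<0$ or $p>r$); an empty determinant is $1$. *)

theory Defs
  imports
    "HOL-Library.Poly_Mapping"
    "HOL-Computational_Algebra.Fraction_Field"
    "HOL-Combinatorics.Permutations"
    "Jordan_Normal_Form.Determinant"
begin

text \<open>
  All sequences (variables, parts of partitions) are indexed from 0: the paper's
  \<open>x\<^sub>i\<close>, \<open>t\<^sub>i\<close>, \<open>\<lambda>\<^sub>i\<close> are \<open>X (i - 1)\<close>, \<open>T (i - 1)\<close>, \<open>lam (i - 1)\<close>.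
  A partition is the infinite sequence of its parts, padded with zeros.
\<close>

definition is_partition :: "(nat \<Rightarrow> nat) \<Rightarrow> bool" where
  "is_partition p \<longleftrightarrow> antimono p \<and> finite {i. p i \<noteq> 0}"

definition plen :: "(nat \<Rightarrow> nat) \<Rightarrow> nat" where
  "plen p = card {i. p i \<noteq> 0}"

definition is_strict_partition :: "(nat \<Rightarrow> nat) \<Rightarrow> bool" where
  "is_strict_partition p \<longleftrightarrow> is_partition p \<and> inj_on p {i. p i \<noteq> 0}"

text \<open>Truncated subtraction pads the staircase with zeros.\<close>

definition staircase :: "nat \<Rightarrow> nat \<Rightarrow> nat" where
  "staircase r = (\<lambda>i. r - i)"

definition padd :: "(nat \<Rightarrow> nat) \<Rightarrow> (nat \<Rightarrow> nat) \<Rightarrow> nat \<Rightarrow> nat" where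
  "padd p q = (\<lambda>i. p i + q i)"

text \<open>
  \<open>tpoly\<close> is \<open>\<int>[t\<^sub>1, t\<^sub>2, \<dots>]\<close> and \<open>xpoly\<close> is \<open>\<int>[t\<^sub>1, t\<^sub>2, \<dots>][x\<^sub>1, x\<^sub>2, \<dots>]\<close>; the keys of the
  polynomial mappings are the exponent vectors.
\<close>

type_synonym tpoly = "(nat \<Rightarrow>\<^sub>0 nat) \<Rightarrow>\<^sub>0 int"
type_synonym xpoly = "(nat \<Rightarrow>\<^sub>0 nat) \<Rightarrow>\<^sub>0 tpoly"

definition T :: "nat \<Rightarrow> tpoly" where
  "T i = Poly_Mapping.single (Poly_Mapping.single i 1) 1"

definition X :: "nat \<Rightarrow> xpoly" where
  "X i = Poly_Mapping.single (Poly_Mapping.single i 1) 1"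

definition Const :: "tpoly \<Rightarrow> xpoly" where
  "Const c = Poly_Mapping.single 0 c"

definition frac :: "xpoly \<Rightarrow> xpoly fract" where
  "frac p = Fract p 1"

definition shifted_power :: "xpoly \<Rightarrow> (nat \<Rightarrow> tpoly) \<Rightarrow> nat \<Rightarrow> xpoly" where
  "shifted_power x t r = (\<Prod>k<r. x - Const (t k))"

text \<open>
  Ivanov's function in \<open>n\<close> variables as a rational function; the parameters \<open>t\<close> are
  arbitrary elements of \<open>tpoly\<close>, so that both \<open>t = T\<close> and \<open>t = 0\<close> are covered.  The action of
  a permutation \<open>w\<close> on the summand is written out as \<open>X i \<mapsto> X (w i)\<close>.
\<close>

definition double_P_rat :: "(nat \<Rightarrow> nat) \<Rightarrow> (nat \<Rightarrow> tpoly) \<Rightarrow> nat \<Rightarrow> xpoly fract" where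
  "double_P_rat lam t n =
     inverse (of_nat (fact (n - plen lam))) *
     (\<Sum>w | w permutes {..<n}.
        (\<Prod>i<plen lam. frac (shifted_power (X (w i)) t (lam i))) *
        (\<Prod>i<plen lam. \<Prod>j\<in>{i<..<n}.
           frac (X (w i) + X (w j)) / frac (X (w i) - X (w j))))"

text \<open>The rational function above is a polynomial whenever \<open>plen lam \<le> n\<close>.\<close>

definition double_P :: "(nat \<Rightarrow> nat) \<Rightarrow> (nat \<Rightarrow> tpoly) \<Rightarrow> nat \<Rightarrow> xpoly" where
  "double_P lam t n = (THE p. frac p = double_P_rat lam t n)"

text \<open>\<open>trunc_vars n\<close> sets all variables \<open>X i\<close> with \<open>i \<ge> n\<close> to zero.\<close>

definition trunc_vars :: "nat \<Rightarrow> xpoly \<Rightarrow> xpoly" where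
  "trunc_vars n p =
     (\<Sum>a | a \<in> Poly_Mapping.keys p \<and> Poly_Mapping.keys a \<subseteq> {..<n}.
        Poly_Mapping.single a (Poly_Mapping.lookup p a))"

text \<open>
  The projective limit of the rings \<open>\<int>[t][x\<^sub>1, \<dots>, x\<^sub>2\<^sub>m]\<close> along the maps
  \<open>x\<^sub>2\<^sub>m\<^sub>+\<^sub>1, x\<^sub>2\<^sub>m\<^sub>+\<^sub>2 \<mapsto> 0\<close>, realised as the set of compatible families with componentwise
  operations.
\<close>

definition even_limit :: "(nat \<Rightarrow> xpoly) set" where
  "even_limit =
     {f. \<forall>m. (\<forall>a\<in>Poly_Mapping.keys (f m). Poly_Mapping.keys a \<subseteq> {..<2 * m}) \<and>
             trunc_vars (2 * m) (f (Suc m)) = f m}"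

text \<open>
  Ivanov's formula only makes sense for \<open>plen lam \<le> 2 * m\<close>; the finitely many lower components
  of a compatible family are determined by the others.
\<close>

definition double_P_lim :: "(nat \<Rightarrow> nat) \<Rightarrow> (nat \<Rightarrow> tpoly) \<Rightarrow> nat \<Rightarrow> xpoly" where
  "double_P_lim lam t =
     (THE f. f \<in> even_limit \<and> (\<forall>m. plen lam \<le> 2 * m \<longrightarrow> f m = double_P lam t (2 * m)))"

definition schur_P_lim :: "(nat \<Rightarrow> nat) \<Rightarrow> nat \<Rightarrow> xpoly" where
  "schur_P_lim lam = double_P_lim lam (\<lambda>_. 0)"

definition elem_sym :: "(nat \<Rightarrow> tpoly) \<Rightarrow> nat \<Rightarrow> int \<Rightarrow> tpoly" where
  "elem_sym u r p =
     (if p < 0 then 0 else \<Sum>A | A \<subseteq> {..<r} \<and> card A = nat p. \<Prod>i\<in>A. u i)"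

definition flagged_S ::
  "(nat \<Rightarrow> nat) \<Rightarrow> (nat \<Rightarrow> nat) \<Rightarrow> (nat \<Rightarrow> nat) \<Rightarrow> (nat \<Rightarrow> tpoly) \<Rightarrow> tpoly" where
  "flagged_S lam mu nu u =
     det (mat (plen lam) (plen lam) (\<lambda>(i, j).
       elem_sym u (lam i) (int (mu i) - int (nu j) + int j - int i)))"

end

theory Submission
  imports Defs
begin

text \<open>
  Each factor of Ivanov's symmetrisation expands as
  \<open>(x | t)\<^sup>r = \<Sum>\<^sub>k x\<^sup>k e\<^bsub>r - k\<^esub>(-t\<^sub>1, \<dots>, -t\<^sub>r)\<close>, so \<open>P\<^sub>\<lambda>(x | t)\<close> is the sum over exponent tuples
  \<open>a\<close> of \<open>\<Prod>\<^sub>i e\<^bsub>\<lambda>\<^sub>i - a\<^sub>i\<^esub>\<close> times the symmetrisation \<open>Q(a)\<close> of the monomial \<open>x\<^sup>a\<close>.  Since \<open>Q\<close> is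
  antisymmetric in \<open>a\<close> (\<open>P_sum_antisym\<close>), the sum collapses to strictly decreasing \<open>a\<close>, with the
  determinant of the \<open>e\<^bsub>\<lambda>\<^sub>i - a\<^sub>j\<^esub>\<close> as coefficient (\<open>sum_antisymmetric_eq_sum_det\<close>).  Writing \<open>a\<close> as a
  staircase plus \<open>\<nu>\<close>, this determinant is the flagged Schur polynomial, and it vanishes unless
  \<open>\<nu> \<subseteq> \<mu>\<close> (\<open>det_zero_block\<close>).

  The parity of \<open>\<ell>\<close> matters for the tuples with \<open>a\<^sub>\<ell> = 0\<close>, as they have only \<open>\<ell> - 1\<close> nonzero
  parts.  In \<open>n\<close> variables, by the partial fraction identity
  \<open>sum_prod_ratio_parity\<close>, \<open>Q(a\<^sub>1, \<dots>, a\<^bsub>\<ell> - 1\<^esub>, 0)\<close> is \<open>Q(a\<^sub>1, \<dots>, a\<^bsub>\<ell> - 1\<^esub>)\<close> if \<open>n - \<ell> + 1\<close> is odd and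
  0 otherwise.  As \<open>n\<close> is even, for even \<open>\<ell>\<close> these tuples give Schur \<open>P\<close>-functions of length \<open>\<ell> - 1\<close>
  and the staircase \<open>\<delta>\<^bsub>\<ell> - 1\<^esub>\<close> appears; for odd \<open>\<ell>\<close> they drop out, all remaining \<open>a\<close> have positive
  parts, and the staircase is \<open>\<delta>\<^sub>\<ell>\<close>.

  Before these identities say anything about polynomials and limits, the symmetrisations must be
  polynomials over the integers, and the families along even \<open>n\<close> must be compatible.  For the first,
  multiplication by the Vandermonde product turns \<open>Q(a)\<close> into an explicit alternating sum with
  integer coefficients (\<open>vandermonde_mult_P_sum\<close>), which is a combination of alternants and hence
  divisible by the Vandermonde product (\<open>vandermonde_dvd_alternating_sum\<close>).  For the second,
  setting one variable to zero in that alternating sum proves stability of the Schur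
  \<open>P\<close>-functions (\<open>trunc_vars_P_poly_Suc\<close>); the double functions inherit it, as the expansion holds
  for every even \<open>n \<ge> \<ell>\<close>.
\<close>

section \<open>Vandermonde determinants and alternating sums\<close>

definition vandermonde :: "nat \<Rightarrow> (nat \<Rightarrow> 'a::comm_ring_1) \<Rightarrow> 'a" where
  "vandermonde n y = (\<Prod>i<n. \<Prod>j\<in>{i<..<n}. y i - y j)"

lemma det_Leibniz:
  "det (mat n n f) = (\<Sum>w | w permutes {..<n}. of_int (sign w) * (\<Prod>i<n. f (i, w i)))"
proof -
  have "det (mat n n f) = (\<Sum>w | w permutes {0..<n}. of_int (sign w) * (\<Prod>i=0..<n. mat n n f $$ (i, w i)))"
    by (rule det_def') simp
  also have "\<dots> = (\<Sum>w | w permutes {0..<n}. of_int (sign w) * (\<Prod>i=0..<n. f (i, w i)))"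
    by (intro sum.cong arg_cong2[of _ _ _ _ "(*)"] prod.cong refl) (simp add: permutes_nat_less)
  finally show ?thesis by (simp add: atLeast0LessThan)
qed

lemma det_Leibniz_rows:
  "det (mat n n f) = (\<Sum>w | w permutes {..<n}. of_int (sign w) * (\<Prod>i<n. f (w i, i)))"
proof -
  have "det (mat n n f) = (\<Sum>w | w permutes {0..<n}. of_int (sign w) * (\<Prod>i<n. mat n n f $$ (w i, i)))"
    by (rule det_col) simp
  also have "\<dots> = (\<Sum>w | w permutes {0..<n}. of_int (sign w) * (\<Prod>i<n. f (w i, i)))"
    by (intro sum.cong arg_cong2[of _ _ _ _ "(*)"] prod.cong refl) (simp add: permutes_nat_less)
  finally show ?thesis by (simp add: atLeast0LessThan)
qed

lemma poly_eq_sum_lessThan: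
  fixes p :: "'a::comm_semiring_1 poly"
  assumes "degree p < n"
  shows "poly p x = (\<Sum>k<n. coeff p k * x ^ k)"
proof -
  have "poly p x = (\<Sum>k\<le>degree p. coeff p k * x ^ k)" by (simp add: poly_altdef)
  also have "\<dots> = (\<Sum>k<n. coeff p k * x ^ k)"
    by (rule sum.mono_neutral_left) (use assms in \<open>auto simp: coeff_eq_0\<close>)
  finally show ?thesis .
qed

text \<open>
  The monic polynomial with prescribed roots.  Over a ring with zero divisors the degree of a
  product is not the sum of the degrees, so degree and leading coefficient are proved together.
\<close>

lemma prod_linear_factors:
  fixes y :: "nat \<Rightarrow> 'a::comm_ring_1"
  assumes "finite A"
  defines "p \<equiv> \<Prod>k\<in>A. [:- y k, 1:]"
  shows "degree p = card A" "coeff p (card A) = 1" "poly p x = (\<Prod>k\<in>A. x - y k)"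
proof -
  have "degree p = card A \<and> coeff p (card A) = 1"
    using assms(1) unfolding p_def
  proof (induction rule: finite_induct)
    case (insert a A)
    let ?p = "\<Prod>k\<in>A. [:- y k, 1:]"
    have 1: "coeff ?p (Suc (card A)) = 0" using insert by (simp add: coeff_eq_0)
    have 2: "[:- y a, 1:] * ?p = smult (- y a) ?p + pCons 0 ?p" by simp
    have c: "coeff ([:- y a, 1:] * ?p) (Suc (card A)) = 1"
      using insert 1 unfolding 2 by simp
    have "degree ([:- y a, 1:] * ?p) \<le> Suc (card A)"
      using degree_mult_le[of "[:- y a, 1:]" ?p] insert by simp
    moreover have "degree ([:- y a, 1:] * ?p) \<ge> Suc (card A)"
      by (rule le_degree) (simp only: c, simp)
    ultimately show ?case using c insert by simp
  qed simp
  thus "degree p = card A" "coeff p (card A) = 1" by auto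
  show "poly p x = (\<Prod>k\<in>A. x - y k)" unfolding p_def by (simp add: poly_prod algebra_simps)
qed

text \<open>
  Multiplying the matrix of powers by a unitriangular matrix replaces the powers by any monic
  polynomials of the same degrees.  For the polynomials \<open>\<Prod>k\<in>{j<..<n}. x - y k\<close> the result is upper
  triangular, since row \<open>i\<close> is killed by the factor \<open>k = i\<close> in every column \<open>j < i\<close>; its diagonal
  entries are the inner products in the definition of \<open>vandermonde\<close>.
\<close>

lemma det_vandermonde:
  fixes y :: "nat \<Rightarrow> 'a::comm_ring_1"
  shows "det (mat n n (\<lambda>(i, j). y i ^ (n - 1 - j))) = vandermonde n y"
proof -
  define p where "p j = (\<Prod>k\<in>{j<..<n}. [:- y k, 1:])" for j
  note p_facts = prod_linear_factors[of "{_<..<n}" y, folded p_def, simplified]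
  let ?V = "mat n n (\<lambda>(i, j). y i ^ (n - 1 - j))"
  let ?U = "mat n n (\<lambda>(i, j). coeff (p j) (n - 1 - i))"
  let ?M = "mat n n (\<lambda>(i, j). \<Prod>k\<in>{j<..<n}. y i - y k)"
  have "?V * ?U = ?M"
  proof (rule eq_matI)
    fix i j assume ij: "i < dim_row ?M" "j < dim_col ?M"
    hence ij': "i < n" "j < n" by auto
    have "(?V * ?U) $$ (i, j) = (\<Sum>k=0..<n. y i ^ (n - 1 - k) * coeff (p j) (n - 1 - k))"
      using ij' by (simp add: scalar_prod_def)
    also have "\<dots> = (\<Sum>k<n. coeff (p j) k * y i ^ k)"
      unfolding atLeast0LessThan
      by (subst sum.nat_diff_reindex[symmetric]) (simp add: mult.commute)
    also have "\<dots> = poly (p j) (y i)"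
      by (rule poly_eq_sum_lessThan[symmetric]) (use ij' in \<open>simp add: p_facts\<close>)
    finally show "(?V * ?U) $$ (i, j) = ?M $$ (i, j)" using ij' by (simp add: p_facts)
  qed auto
  hence "det ?V * det ?U = det ?M" by (metis det_mult mat_carrier)
  moreover have "det ?U = prod_list (diag_mat ?U)"
    by (rule det_lower_triangular[of n]) (auto simp: coeff_eq_0 p_facts)
  moreover have "prod_list (diag_mat ?U) = 1"
  proof -
    have "coeff (p i) (n - Suc i) = 1" if "i < n" for i using that p_facts(2)[of i] by simp
    thus ?thesis by (simp add: prod_list_diag_prod)
  qed
  moreover have "det ?M = prod_list (diag_mat ?M)"
    by (rule det_upper_triangular[of _ n]) (auto simp: upper_triangular_def intro!: prod_zero)
  moreover have "prod_list (diag_mat ?M) = vandermonde n y"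
    by (simp add: prod_list_diag_prod vandermonde_def atLeast0LessThan)
  ultimately show ?thesis by simp
qed

lemma vandermonde_permute:
  assumes "w permutes {..<n}"
  shows "vandermonde n (\<lambda>i. y (w i)) = of_int (sign w) * vandermonde n y"
proof -
  let ?V = "mat n n (\<lambda>(i, j). y i ^ (n - 1 - j))"
  have "mat n n (\<lambda>(i, j). y (w i) ^ (n - 1 - j)) = mat n n (\<lambda>(i, j). ?V $$ (w i, j))"
    using permutes_in_image[OF assms] by (intro eq_matI) auto
  hence "vandermonde n (\<lambda>i. y (w i)) = det (mat n n (\<lambda>(i, j). ?V $$ (w i, j)))"
    by (metis det_vandermonde)
  also have "\<dots> = of_int (sign w) * det ?V"
    by (rule det_permute_rows) (use assms in \<open>auto simp: atLeast0LessThan\<close>)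
  finally show ?thesis by (simp only: det_vandermonde)
qed

text \<open>
  Each \<open>y i\<close> is a root of one monic polynomial of degree \<open>n\<close>, so modulo that polynomial all powers
  reduce to the first \<open>n\<close> ones, with coefficients that are the same for every \<open>i\<close>.
\<close>

lemma power_reduction:
  fixes y :: "nat \<Rightarrow> 'a::comm_ring_1"
  shows "\<exists>c. \<forall>i<n. y i ^ b = (\<Sum>k<n. c k * y i ^ k)"
proof (induction b)
  case 0
  show ?case
    by (rule exI[of _ "\<lambda>k. if k = 0 then 1 else 0"]) (auto simp: if_distrib[of "\<lambda>x. x * _"] sum.delta cong: if_cong)
next
  case (Suc b)
  then obtain c where c: "\<And>i. i < n \<Longrightarrow> y i ^ b = (\<Sum>k<n. c k * y i ^ k)" by blast
  define p where "p = (\<Prod>k<n. [:- y k, 1:])"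
  note p_facts = prod_linear_factors[of "{..<n}" y, folded p_def, simplified]
  show ?case
  proof (cases n)
    case (Suc m)
    have "y i ^ Suc b = (\<Sum>k<n. ((if k = 0 then 0 else c (k - 1)) - c m * coeff p k) * y i ^ k)"
      if i: "i < n" for i
    proof -
      have "(\<Prod>k<n. y i - y k) = 0" using i by (intro prod_zero) auto
      hence "0 = poly p (y i)" by (simp add: p_facts)
      also have "\<dots> = (\<Sum>k<n. coeff p k * y i ^ k) + y i ^ n"
        using poly_eq_sum_lessThan[of p "Suc n" "y i"] p_facts by simp
      finally have top: "y i ^ n = - (\<Sum>k<n. coeff p k * y i ^ k)"
        by (metis eq_neg_iff_add_eq_0 add.commute)
      have "y i ^ Suc b = (\<Sum>k<n. c k * y i ^ Suc k)"
        by (simp add: c[OF i] sum_distrib_left mult_ac)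
      also have "\<dots> = (\<Sum>k<m. c k * y i ^ Suc k) + c m * y i ^ n" by (simp add: Suc)
      also have "(\<Sum>k<m. c k * y i ^ Suc k) = (\<Sum>k<n. (if k = 0 then 0 else c (k - 1)) * y i ^ k)"
        unfolding Suc by (subst sum.lessThan_Suc_shift) simp
      finally show ?thesis
        by (simp only: top mult_minus_right sum_distrib_left left_diff_distrib mult.assoc
            sum_subtractf diff_conv_add_uminus[symmetric])
    qed
    thus ?thesis by (intro exI[of _ "\<lambda>k. (if k = 0 then 0 else c (k - 1)) - c m * coeff p k"]) blast
  qed auto
qed

text \<open>
  By \<open>power_reduction\<close> the matrix of the powers \<open>y i ^ b j\<close> factors through the Vandermonde matrix.
  This gives the divisibility over any commutative ring, without unique factorisation and without
  the vanishing argument for alternating polynomials.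
\<close>

lemma vandermonde_dvd_alternant:
  fixes y :: "nat \<Rightarrow> 'a::comm_ring_1"
  shows "vandermonde n y dvd (\<Sum>w | w permutes {..<n}. of_int (sign w) * (\<Prod>i<n. y (w i) ^ b i))"
proof -
  have "\<exists>c. \<forall>i<n. y i ^ b j = (\<Sum>k<n. c k * y i ^ k)" for j by (rule power_reduction)
  then obtain c where c: "\<And>i j. i < n \<Longrightarrow> y i ^ b j = (\<Sum>k<n. c j k * y i ^ k)" by metis
  let ?V = "mat n n (\<lambda>(i, j). y i ^ (n - 1 - j))"
  let ?C = "mat n n (\<lambda>(i, j). c j (n - 1 - i))"
  let ?M = "mat n n (\<lambda>(i, j). y i ^ b j)"
  have "?V * ?C = ?M"
  proof (rule eq_matI)
    fix i j assume ij: "i < dim_row ?M" "j < dim_col ?M"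
    hence ij': "i < n" "j < n" by auto
    have "(?V * ?C) $$ (i, j) = (\<Sum>k=0..<n. y i ^ (n - 1 - k) * c j (n - 1 - k))"
      using ij' by (simp add: scalar_prod_def)
    also have "\<dots> = (\<Sum>k<n. c j k * y i ^ k)"
      unfolding atLeast0LessThan
      by (subst sum.nat_diff_reindex[symmetric]) (simp add: mult.commute)
    finally show "(?V * ?C) $$ (i, j) = ?M $$ (i, j)" using ij' by (simp add: c)
  qed auto
  hence "det ?V * det ?C = det ?M" by (metis det_mult mat_carrier)
  moreover have "det ?M = (\<Sum>w | w permutes {..<n}. of_int (sign w) * (\<Prod>i<n. y (w i) ^ b i))"
    by (simp add: det_Leibniz_rows)
  ultimately show ?thesis unfolding det_vandermonde by (metis dvd_triv_left)
qed

text \<open>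
  Multiplying out one factor \<open>y (w i) + y (w j)\<close> at a time splits the sum into two sums of the same
  form with a larger exponent vector, which reduces the claim to alternants.
\<close>

lemma vandermonde_dvd_alternating_sum:
  fixes y :: "nat \<Rightarrow> 'a::comm_ring_1"
  assumes "finite S" "\<And>i j. (i, j) \<in> S \<Longrightarrow> i < n \<and> j < n"
  shows "vandermonde n y dvd
    (\<Sum>w | w permutes {..<n}. of_int (sign w) * ((\<Prod>i<n. y (w i) ^ b i) * (\<Prod>(i, j)\<in>S. y (w i) + y (w j))))"
  using assms
proof (induction S arbitrary: b rule: finite_induct)
  case empty
  thus ?case using vandermonde_dvd_alternant[of n y b] by simp
next
  case (insert e S)
  obtain i0 j0 where e: "e = (i0, j0)" by (cases e)
  have lt: "i0 < n" "j0 < n" using insert.prems[of i0 j0] e by auto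
  have shift: "(\<Prod>i<n. z i ^ (b(k := Suc (b k))) i) = z k * (\<Prod>i<n. z i ^ b i)" if "k < n" for k and z :: "nat \<Rightarrow> 'a"
  proof -
    have "(\<Prod>i<n. z i ^ (b(k := Suc (b k))) i) = z k ^ Suc (b k) * (\<Prod>i\<in>{..<n} - {k}. z i ^ (b(k := Suc (b k))) i)"
      using that by (subst prod.remove[of _ k]) auto
    also have "\<dots> = z k ^ Suc (b k) * (\<Prod>i\<in>{..<n} - {k}. z i ^ b i)"
      by (intro arg_cong2[of _ _ _ _ "(*)"] prod.cong) auto
    also have "\<dots> = z k * (\<Prod>i<n. z i ^ b i)"
      using that by (subst prod.remove[of "{..<n}" k]) auto
    finally show ?thesis .
  qed
  let ?F = "\<lambda>b. \<Sum>w | w permutes {..<n}. of_int (sign w) * ((\<Prod>i<n. y (w i) ^ b i) * (\<Prod>(i, j)\<in>S. y (w i) + y (w j)))"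
  have "(\<Sum>w | w permutes {..<n}. of_int (sign w) * ((\<Prod>i<n. y (w i) ^ b i) * (\<Prod>(i, j)\<in>insert e S. y (w i) + y (w j))))
     = ?F (b(i0 := Suc (b i0))) + ?F (b(j0 := Suc (b j0)))"
    unfolding sum.distrib[symmetric] using insert.hyps
    by (intro sum.cong refl) (simp add: e shift[OF lt(1)] shift[OF lt(2)] algebra_simps del: fun_upd_apply)
  moreover have "vandermonde n y dvd ?F b'" for b' using insert.prems by (intro insert.IH) auto
  ultimately show ?case by simp
qed

section \<open>Symmetrised monomials over a field\<close>

text \<open>
  Ivanov's symmetrisation of a single monomial \<open>x\<^sup>a\<close>, without the factor \<open>1 / (n - l)!\<close>.  The
  exponents are arbitrary: they may vanish or repeat, as happens for the terms that arise
  when the factors \<open>(x | t)\<^sup>r\<close> are expanded in powers of \<open>x\<close>.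
\<close>

definition P_sum :: "nat \<Rightarrow> (nat \<Rightarrow> nat) \<Rightarrow> nat \<Rightarrow> (nat \<Rightarrow> 'a::field) \<Rightarrow> 'a" where
  "P_sum l a n y = (\<Sum>w | w permutes {..<n}. (\<Prod>i<l. y (w i) ^ a i) *
     (\<Prod>i<l. \<Prod>j\<in>{i<..<n}. (y (w i) + y (w j)) / (y (w i) - y (w j))))"

text \<open>
  The numerator of \<open>P_sum / (n - l)!\<close> over the common denominator \<open>vandermonde n y\<close>.  The exponents
  \<open>n - 1 - i\<close> in the last \<open>n - l\<close> places come from a Vandermonde determinant in those variables, whose
  \<open>(n - l)!\<close> terms cancel the factorial, so the numerator has integer coefficients.
\<close>

definition P_alt :: "nat \<Rightarrow> (nat \<Rightarrow> nat) \<Rightarrow> nat \<Rightarrow> (nat \<Rightarrow> 'a::comm_ring_1) \<Rightarrow> 'a" where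
  "P_alt l a n y = (\<Sum>w | w permutes {..<n}. of_int (sign w) *
     ((\<Prod>i<l. y (w i) ^ a i) * (\<Prod>i\<in>{l..<n}. y (w i) ^ (n - 1 - i)) *
      (\<Prod>i<l. \<Prod>j\<in>{i<..<n}. y (w i) + y (w j))))"

lemma P_sum_cong: "(\<And>i. i < l \<Longrightarrow> a i = b i) \<Longrightarrow> P_sum l a n y = P_sum l b n y"
  unfolding P_sum_def by (intro sum.cong arg_cong2[of _ _ _ _ "(*)"] prod.cong) auto

lemma prod_lessThan_split:
  fixes f :: "nat \<Rightarrow> 'a::comm_monoid_mult"
  assumes "l \<le> n"
  shows "(\<Prod>i<n. f i) = (\<Prod>i<l. f i) * (\<Prod>i\<in>{l..<n}. f i)"
  using prod.atLeastLessThan_concat[of 0 l n f] assms by (simp add: atLeast0LessThan)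

lemma vandermonde_dvd_P_alt:
  assumes "l \<le> n"
  shows "vandermonde n y dvd P_alt l a n y"
proof -
  let ?S = "Sigma {..<l} (\<lambda>i. {i<..<n})"
  let ?b = "\<lambda>i. if i < l then a i else n - 1 - i"
  have "P_alt l a n y = (\<Sum>w | w permutes {..<n}. of_int (sign w) *
     ((\<Prod>i<n. y (w i) ^ ?b i) * (\<Prod>(i, j)\<in>?S. y (w i) + y (w j))))"
    unfolding P_alt_def
  proof (intro sum.cong arg_cong2[of _ _ _ _ "(*)"] refl)
    fix w
    show "(\<Prod>i<l. y (w i) ^ a i) * (\<Prod>i\<in>{l..<n}. y (w i) ^ (n - 1 - i)) = (\<Prod>i<n. y (w i) ^ ?b i)"
      unfolding prod_lessThan_split[OF assms] by (intro arg_cong2[of _ _ _ _ "(*)"] prod.cong) auto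
    show "(\<Prod>i<l. \<Prod>j\<in>{i<..<n}. y (w i) + y (w j)) = (\<Prod>(i, j)\<in>?S. y (w i) + y (w j))"
      by (rule prod.Sigma) auto
  qed
  also have "vandermonde n y dvd \<dots>"
    by (rule vandermonde_dvd_alternating_sum) (use assms in auto)
  finally show ?thesis .
qed

text \<open>
  The Leibniz expansion of the Vandermonde determinant in the variables \<open>y l, \<dots>, y (n - 1)\<close>, written
  with permutations of the index set \<open>{l..<n}\<close> so that they can be composed with permutations
  of \<open>{..<n}\<close>.
\<close>

lemma vandermonde_block:
  fixes y :: "nat \<Rightarrow> 'a::comm_ring_1"
  shows "(\<Prod>i\<in>{l..<n}. \<Prod>j\<in>{i<..<n}. y i - y j)
    = (\<Sum>s | s permutes {l..<n}. of_int (sign s) * (\<Prod>i\<in>{l..<n}. y (s i) ^ (n - 1 - i)))"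
proof -
  let ?m = "n - l"
  let ?A = "{..<?m}" and ?B = "{l..<n}"
  let ?f = "map_permutation ?A ((+) l)"
  have bij0: "bij_betw ((+) l) ?A ?B"
    by (rule bij_betw_byWitness[of _ "\<lambda>i. i - l"]) auto
  hence img: "(+) l ` ?A = ?B" by (simp add: bij_betw_def)
  have bij: "bij_betw ?f {s. s permutes ?A} {s. s permutes ?B}"
    using bij_betw_permutations[OF bij0]
    by (rule bij_betw_cong[THEN iffD1, rotated]) (auto simp: map_permutation_def restrict_id_def fun_eq_iff img)
  have reindex: "(\<Prod>i\<in>?B. h i) = (\<Prod>i<?m. h (l + i))" for h :: "nat \<Rightarrow> 'a"
    by (rule prod.reindex_bij_betw[OF bij0, symmetric])
  have "(\<Prod>i\<in>?B. \<Prod>j\<in>{i<..<n}. y i - y j) = vandermonde ?m (\<lambda>i. y (l + i))"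
    unfolding reindex vandermonde_def
  proof (rule prod.cong[OF refl])
    fix i assume "i \<in> ?A"
    hence "bij_betw ((+) l) {i<..<?m} {l + i<..<n}"
      by (intro bij_betw_byWitness[of _ "\<lambda>i. i - l"]) auto
    from prod.reindex_bij_betw[OF this, of "\<lambda>j. y (l + i) - y j"]
    show "(\<Prod>j\<in>{l + i<..<n}. y (l + i) - y j) = (\<Prod>j\<in>{i<..<?m}. y (l + i) - y (l + j))" by simp
  qed
  also have "\<dots> = (\<Sum>s | s permutes ?A. of_int (sign s) * (\<Prod>i<?m. y (l + s i) ^ (?m - 1 - i)))"
    unfolding det_vandermonde[symmetric] det_Leibniz_rows by simp
  also have "\<dots> = (\<Sum>s | s permutes ?A. of_int (sign (?f s)) * (\<Prod>i\<in>?B. y (?f s i) ^ (n - 1 - i)))"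
    unfolding reindex
  proof (intro sum.cong refl)
    fix s assume "s \<in> {s. s permutes ?A}"
    hence "of_int (sign (?f s)) = (of_int (sign s) :: 'a)" by (simp add: sign_map_permutation)
    moreover have "(\<Prod>i<?m. y (?f s (l + i)) ^ (n - 1 - (l + i))) = (\<Prod>i<?m. y (l + s i) ^ (?m - 1 - i))"
      by (intro prod.cong refl) (simp add: map_permutation_apply)
    ultimately show "of_int (sign s) * (\<Prod>i<?m. y (l + s i) ^ (?m - 1 - i))
      = of_int (sign (?f s)) * (\<Prod>i<?m. y (?f s (l + i)) ^ (n - 1 - (l + i)))" by simp
  qed
  also have "\<dots> = (\<Sum>s | s permutes ?B. of_int (sign s) * (\<Prod>i\<in>?B. y (s i) ^ (n - 1 - i)))"
    by (rule sum.reindex_bij_betw[OF bij])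
  finally show ?thesis .
qed

lemma vandermonde_split:
  assumes "l \<le> n"
  shows "vandermonde n y = (\<Prod>i<l. \<Prod>j\<in>{i<..<n}. y i - y j) * (\<Prod>i\<in>{l..<n}. \<Prod>j\<in>{i<..<n}. y i - y j)"
  unfolding vandermonde_def by (rule prod_lessThan_split[OF assms])

text \<open>
  The Vandermonde product is alternating, so it can be moved inside the symmetrisation at the cost of
  a sign.  There it cancels the denominators and leaves the differences of the last \<open>n - l\<close>
  variables, which \<open>vandermonde_block\<close> expands as a sum over the permutations \<open>s\<close> of those places.  The
  rest of the summand is invariant under \<open>s\<close>, so substituting \<open>w \<circ> s\<close> for \<open>w\<close> shows that all
  \<open>(n - l)!\<close> values of \<open>s\<close> contribute the same amount.
\<close>

lemma vandermonde_mult_P_sum: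
  fixes y :: "nat \<Rightarrow> 'a::field"
  assumes l: "l \<le> n" and inj: "inj_on y {..<n}"
  shows "vandermonde n y * P_sum l a n y = of_nat (fact (n - l)) * P_alt l a n y"
proof -
  let ?B = "{l..<n}"
  define K where "K w = (\<Prod>i<l. y (w i) ^ a i) * (\<Prod>i<l. \<Prod>j\<in>{i<..<n}. y (w i) + y (w j))" for w
  define E where "E w = (\<Prod>i\<in>?B. y (w i) ^ (n - 1 - i))" for w
  have term_eq: "vandermonde n y * ((\<Prod>i<l. y (w i) ^ a i) *
      (\<Prod>i<l. \<Prod>j\<in>{i<..<n}. (y (w i) + y (w j)) / (y (w i) - y (w j))))
    = (\<Sum>s | s permutes ?B. of_int (sign (w \<circ> s)) * (K (w \<circ> s) * E (w \<circ> s)))" (is "?lhs = ?rhs")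
    if w: "w permutes {..<n}" for w
  proof -
    let ?z = "\<lambda>i. y (w i)"
    let ?D = "\<Prod>i<l. \<Prod>j\<in>{i<..<n}. ?z i - ?z j"
    have "?z i \<noteq> ?z j" if "i < n" "j < n" "i \<noteq> j" for i j
      using inj_onD[OF inj, of "w i" "w j"] permutes_in_image[OF w] permutes_inj[OF w] that
      by (auto simp: inj_eq)
    hence D: "?D \<noteq> 0" using l by (auto simp: prod_zero_iff)
    have "vandermonde n ?z = of_int (sign w) * vandermonde n y"
      by (rule vandermonde_permute[OF w])
    hence "of_int (sign w) * vandermonde n ?z = (of_int (sign w * sign w) :: 'a) * vandermonde n y"
      by (simp del: sign_idempotent)
    hence V: "vandermonde n y = of_int (sign w) * (?D * (\<Prod>i\<in>?B. \<Prod>j\<in>{i<..<n}. ?z i - ?z j))"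
      using vandermonde_split[OF l, of ?z] by simp
    \<comment> \<open>The factor \<open>?D\<close> cancels the denominators of the ratios.\<close>
    have "?lhs = of_int (sign w) * (K w * (\<Prod>i\<in>?B. \<Prod>j\<in>{i<..<n}. ?z i - ?z j))"
      unfolding V K_def prod_dividef using D by (simp add: field_simps)
    also have "\<dots> = (\<Sum>s | s permutes ?B. of_int (sign w * sign s) * (K w * E (w \<circ> s)))"
      unfolding vandermonde_block[where l = l and n = n and y = ?z] by (simp add: sum_distrib_left E_def mult_ac)
    also have "\<dots> = ?rhs"
    proof (intro sum.cong refl)
      fix s assume "s \<in> {s. s permutes ?B}"
      hence s: "s permutes ?B" by simp
      have fix_s: "s i = i" if "i < l" for i using permutes_not_in[OF s, of i] that by simp
      have "(\<Prod>j\<in>{i<..<n}. y (w i) + y (w (s j))) = (\<Prod>j\<in>{i<..<n}. y (w i) + y (w j))" if "i < l" for i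
      proof -
        have "s permutes {i<..<n}" by (rule permutes_subset[OF s]) (use that in auto)
        from prod.permute[OF this, of "\<lambda>j. y (w i) + y (w j)"] show ?thesis by (simp add: o_def)
      qed
      hence "K (w \<circ> s) = K w" unfolding K_def by (simp add: fix_s)
      moreover have "sign (w \<circ> s) = sign w * sign s"
        by (intro sign_compose) (use s w in \<open>auto intro: permutes_imp_permutation[rotated]\<close>)
      ultimately show "of_int (sign w * sign s) * (K w * E (w \<circ> s)) =
        of_int (sign (w \<circ> s)) * (K (w \<circ> s) * E (w \<circ> s))" by simp
    qed
    finally show ?thesis .
  qed
  have "vandermonde n y * P_sum l a n y
    = (\<Sum>w | w permutes {..<n}. \<Sum>s | s permutes ?B. of_int (sign (w \<circ> s)) * (K (w \<circ> s) * E (w \<circ> s)))"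
    unfolding P_sum_def sum_distrib_left by (intro sum.cong refl term_eq) simp
  also have "\<dots> = (\<Sum>s | s permutes ?B. \<Sum>w | w permutes {..<n}. of_int (sign (w \<circ> s)) * (K (w \<circ> s) * E (w \<circ> s)))"
    by (rule sum.swap)
  also have "\<dots> = (\<Sum>s | s permutes ?B. \<Sum>w | w permutes {..<n}. of_int (sign w) * (K w * E w))"
  proof (rule sum.cong[OF refl])
    fix s assume "s \<in> {s. s permutes ?B}"
    hence "s permutes {..<n}" by (auto intro: permutes_subset)
    from sum_permutations_compose_right[OF this, of "\<lambda>w. of_int (sign w) * (K w * E w)"]
    show "(\<Sum>w | w permutes {..<n}. of_int (sign (w \<circ> s)) * (K (w \<circ> s) * E (w \<circ> s)))
      = (\<Sum>w | w permutes {..<n}. of_int (sign w) * (K w * E w))" by simp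
  qed
  also have "\<dots> = of_nat (fact (n - l)) * P_alt l a n y"
    unfolding P_alt_def K_def E_def by (simp add: card_permutations[of ?B "n - l"] mult_ac)
  finally show ?thesis .
qed

text \<open>
  Permuting the exponents amounts to permuting the first \<open>l\<close> variables of the product of the ratios
  \<open>(z i + z j) / (z i - z j)\<close>.  The ratios with \<open>j \<ge> l\<close> are only rearranged, and those with \<open>j < l\<close>
  change by the sign, because \<open>(z i + z j) / (z i - z j) = ((z i)\<^sup>2 - (z j)\<^sup>2) / (z i - z j)\<^sup>2\<close> turns
  their product into one Vandermonde product over the square of another.
\<close>

lemma P_sum_antisym:
  fixes y :: "nat \<Rightarrow> 'a::field"
  assumes l: "l \<le> n" and s: "s permutes {..<l}"
  shows "P_sum l (\<lambda>i. a (s i)) n y = of_int (sign s) * P_sum l a n y"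
proof -
  let ?g = "\<lambda>z i j. (z i + z j) / (z i - z j :: 'a)"
  let ?D = "\<lambda>z. \<Prod>i<l. \<Prod>j\<in>{i<..<n}. ?g z i j"
  have D_eq: "?D z = vandermonde l (\<lambda>i. (z i)\<^sup>2) / (vandermonde l z)\<^sup>2 * (\<Prod>i<l. \<Prod>j\<in>{l..<n}. ?g z i j)" for z
  proof -
    have "?D z = (\<Prod>i<l. (\<Prod>j\<in>{i<..<l}. ?g z i j) * (\<Prod>j\<in>{l..<n}. ?g z i j))"
    proof (intro prod.cong refl)
      fix i assume "i \<in> {..<l}"
      hence "{i<..<n} = {i<..<l} \<union> {l..<n}" using l by auto
      moreover have "{i<..<l} \<inter> {l..<n} = {}" by auto
      ultimately show "(\<Prod>j\<in>{i<..<n}. ?g z i j) = (\<Prod>j\<in>{i<..<l}. ?g z i j) * (\<Prod>j\<in>{l..<n}. ?g z i j)"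
        by (simp add: prod.union_disjoint)
    qed
    also have "\<dots> = (\<Prod>i<l. \<Prod>j\<in>{i<..<l}. ?g z i j) * (\<Prod>i<l. \<Prod>j\<in>{l..<n}. ?g z i j)"
      by (rule prod.distrib)
    also have "(\<Prod>i<l. \<Prod>j\<in>{i<..<l}. ?g z i j)
      = (\<Prod>i<l. \<Prod>j\<in>{i<..<l}. ((z i)\<^sup>2 - (z j)\<^sup>2) / (z i - z j)\<^sup>2)"
      \<comment> \<open>If the two values agree, both fractions are 0 by division by zero.\<close>
      by (intro prod.cong refl) (simp add: power2_eq_square square_diff_square_factored)
    also have "\<dots> = vandermonde l (\<lambda>i. (z i)\<^sup>2) / (vandermonde l z)\<^sup>2"
      unfolding vandermonde_def by (simp add: prod_dividef prod_power_distrib)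
    finally show ?thesis .
  qed
  have D_perm: "?D (\<lambda>i. z (s i)) = of_int (sign s) * ?D z"
    if z: "\<And>j. j \<ge> l \<Longrightarrow> z (s j) = z j" for z
  proof -
    have "(\<Prod>i<l. \<Prod>j\<in>{l..<n}. ?g (\<lambda>i. z (s i)) i j) = (\<Prod>i<l. \<Prod>j\<in>{l..<n}. (z (s i) + z j) / (z (s i) - z j))"
      using z by (intro prod.cong refl) auto
    also have "\<dots> = (\<Prod>i<l. \<Prod>j\<in>{l..<n}. ?g z i j)"
      using prod.permute[OF s, of "\<lambda>i. \<Prod>j\<in>{l..<n}. ?g z i j"] by (simp add: o_def)
    finally have 1: "(\<Prod>i<l. \<Prod>j\<in>{l..<n}. ?g (\<lambda>i. z (s i)) i j) = (\<Prod>i<l. \<Prod>j\<in>{l..<n}. ?g z i j)" .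
    have sq: "(of_int (sign s) :: 'a)\<^sup>2 = 1" by (simp add: sign_def)
    show ?thesis
      unfolding D_eq 1 vandermonde_permute[OF s, of z] vandermonde_permute[OF s, of "\<lambda>i. (z i)\<^sup>2"]
        power_mult_distrib sq by simp
  qed
  have s': "s permutes {..<n}" by (rule permutes_subset[OF s]) (use l in auto)
  have "P_sum l (\<lambda>i. a (s i)) n y = (\<Sum>w | w permutes {..<n}. (\<Prod>i<l. y (w (s i)) ^ a (s i)) * ?D (\<lambda>i. y (w (s i))))"
    unfolding P_sum_def by (subst sum_permutations_compose_right[OF s']) simp
  also have "\<dots> = (\<Sum>w | w permutes {..<n}. of_int (sign s) * ((\<Prod>i<l. y (w i) ^ a i) * ?D (\<lambda>i. y (w i))))"
  proof (intro sum.cong refl)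
    fix w
    have "(\<Prod>i<l. y (w (s i)) ^ a (s i)) = (\<Prod>i<l. y (w i) ^ a i)"
      using prod.permute[OF s, of "\<lambda>i. y (w i) ^ a i"] by (simp add: o_def)
    moreover have "?D (\<lambda>i. y (w (s i))) = of_int (sign s) * ?D (\<lambda>i. y (w i))"
      by (rule D_perm) (use permutes_not_in[OF s] in simp)
    ultimately show "(\<Prod>i<l. y (w (s i)) ^ a (s i)) * ?D (\<lambda>i. y (w (s i)))
      = of_int (sign s) * ((\<Prod>i<l. y (w i) ^ a i) * ?D (\<lambda>i. y (w i)))" by simp
  qed
  also have "\<dots> = of_int (sign s) * P_sum l a n y"
    unfolding P_sum_def by (simp add: sum_distrib_left)
  finally show ?thesis .
qed

lemma P_sum_not_inj:
  fixes y :: "nat \<Rightarrow> 'a::field"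
  assumes l: "l \<le> n" and two: "(2::'a) \<noteq> 0" and "\<not> inj_on a {..<l}"
  shows "P_sum l a n y = 0"
proof -
  obtain i j where ij: "i < l" "j < l" "i \<noteq> j" "a i = a j" using assms(3) by (auto simp: inj_on_def)
  have "(\<lambda>k. a (transpose i j k)) = a" using ij by (auto simp: transpose_def)
  moreover have "transpose i j permutes {..<l}" using ij by (intro permutes_swap_id) auto
  ultimately have "P_sum l a n y = - P_sum l a n y"
    using P_sum_antisym[OF l, where s = "transpose i j" and a = a and y = y] ij by (simp add: sign_swap_id)
  hence "2 * P_sum l a n y = 0" by (metis add.right_inverse mult_2)
  thus ?thesis using two by simp
qed

section \<open>A vanishing last exponent\<close>

text \<open>
  The polynomial \<open>\<Prod>(x + z j) - \<Prod>(x - z j)\<close> has degree less than \<open>card A\<close>, hence equals its Lagrange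
  interpolant at the points \<open>z k\<close>.  Its value at \<open>z k\<close> is \<open>2 z k \<Prod>\<^bsub>j \<noteq> k\<^esub> (z k + z j)\<close>.  Comparing both
  at \<open>x = 0\<close> and dividing by \<open>\<Prod>z j\<close> gives \<open>1 - (-1)\<^sup>m = -2 (-1)\<^sup>m S\<close> for the sum \<open>S\<close> in question, with
  \<open>m = card A\<close>.
\<close>

lemma sum_prod_ratio_parity:
  fixes z :: "nat \<Rightarrow> 'a::field"
  assumes fin: "finite A" and inj: "inj_on z A" and nz: "\<And>k. k \<in> A \<Longrightarrow> z k \<noteq> 0" and two: "(2::'a) \<noteq> 0"
  shows "(\<Sum>k\<in>A. \<Prod>j\<in>A - {k}. (z k + z j) / (z k - z j)) = (if odd (card A) then 1 else 0)"
proof (cases "A = {}")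
  case False
  define m where "m = card A"
  have m: "m > 0" using fin False by (simp add: m_def card_gt_0_iff)
  define p where "p = (\<Prod>j\<in>A. [:z j, 1:])"
  define q where "q = (\<Prod>j\<in>A. [:- z j, 1:])"
  define r where "r k = (\<Prod>j\<in>A - {k}. [:- z j, 1:])" for k
  have p: "degree p = m" "coeff p m = 1" "poly p x = (\<Prod>j\<in>A. x + z j)" for x
    using prod_linear_factors[OF fin, of "\<lambda>j. - z j"] by (simp_all add: p_def m_def)
  have q: "degree q = m" "coeff q m = 1" "poly q x = (\<Prod>j\<in>A. x - z j)" for x
    using prod_linear_factors[OF fin, of z] by (simp_all add: q_def m_def)
  have r: "degree (r k) = m - 1" "poly (r k) x = (\<Prod>j\<in>A - {k}. x - z j)" if "k \<in> A" for k x
    using prod_linear_factors[of "A - {k}" z] fin that by (simp_all add: r_def m_def)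
  define c where "c k = poly p (z k) / (\<Prod>j\<in>A - {k}. z k - z j)" for k
  have c: "c k = 2 * z k * (\<Prod>j\<in>A - {k}. (z k + z j) / (z k - z j))" if "k \<in> A" for k
  proof -
    have "poly p (z k) = (z k + z k) * (\<Prod>j\<in>A - {k}. z k + z j)"
      unfolding p by (rule prod.remove[OF fin that])
    thus ?thesis by (simp add: c_def prod_dividef)
  qed
  have "p - q = (\<Sum>k\<in>A. smult (c k) (r k))"
  proof (rule poly_eqI_degree)
    have "degree (p - q) \<le> m" using p q by (metis degree_diff_le order_refl)
    moreover have "degree (p - q) \<noteq> m"
    proof
      assume d: "degree (p - q) = m"
      have "coeff (p - q) m = 0" using p q by simp
      hence "p - q = 0" using d by (metis leading_coeff_0_iff)
      thus False using d m by simp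
    qed
    moreover have "card (z ` A) = m" using inj by (simp add: card_image m_def)
    ultimately show "degree (p - q) < card (z ` A)" by simp
    have "degree (\<Sum>k\<in>A. smult (c k) (r k)) < m"
      by (rule degree_sum_less) (use m r in \<open>auto intro: le_less_trans[OF degree_smult_le]\<close>)
    thus "degree (\<Sum>k\<in>A. smult (c k) (r k)) < card (z ` A)" using \<open>card (z ` A) = m\<close> by simp
  next
    fix x assume "x \<in> z ` A"
    then obtain i where i: "i \<in> A" "x = z i" by auto
    have "poly q x = 0" using fin i by (auto simp: q intro!: prod_zero)
    moreover have "poly (\<Sum>k\<in>A. smult (c k) (r k)) x = (\<Sum>k\<in>A. c k * poly (r k) x)" by (simp add: poly_sum)
    moreover have "\<dots> = c i * poly (r i) x"
    proof (rule sum.remove[OF fin i(1), THEN trans])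
      have "(\<Sum>k\<in>A - {i}. c k * poly (r k) x) = 0"
        using fin i by (intro sum.neutral) (auto simp: r intro!: prod_zero)
      thus "c i * poly (r i) x + (\<Sum>k\<in>A - {i}. c k * poly (r k) x) = c i * poly (r i) x" by simp
    qed
    moreover have "(\<Prod>j\<in>A - {i}. z i - z j) \<noteq> 0"
      using fin inj i by (auto simp: prod_zero_iff inj_on_def)
    ultimately show "poly (p - q) x = poly (\<Sum>k\<in>A. smult (c k) (r k)) x"
      using i by (simp add: c_def r)
  qed
  hence "poly (p - q) 0 = poly (\<Sum>k\<in>A. smult (c k) (r k)) 0" by simp
  moreover have "poly (p - q) 0 = (1 - (-1) ^ m) * (\<Prod>j\<in>A. z j)"
    using prod_uminus[of z A] by (simp add: p q m_def algebra_simps)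
  moreover have "poly (\<Sum>k\<in>A. smult (c k) (r k)) 0 = (\<Sum>k\<in>A. c k * poly (r k) 0)" by (simp add: poly_sum)
  moreover have "\<dots> = (\<Sum>k\<in>A. - (2 * (-1) ^ m * (\<Prod>j\<in>A. z j)) * (\<Prod>j\<in>A - {k}. (z k + z j) / (z k - z j)))"
  proof (rule sum.cong[OF refl])
    fix k assume k: "k \<in> A"
    have "poly (r k) 0 = (-1) ^ (m - 1) * (\<Prod>j\<in>A - {k}. z j)"
      using prod_uminus[of z "A - {k}"] k fin by (simp add: r m_def)
    moreover have "(-1 :: 'a) ^ (m - 1) = - ((-1) ^ m)" using m by (cases m) auto
    moreover have "(\<Prod>j\<in>A. z j) = z k * (\<Prod>j\<in>A - {k}. z j)" by (rule prod.remove[OF fin k])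
    ultimately show "c k * poly (r k) 0
      = - (2 * (-1) ^ m * (\<Prod>j\<in>A. z j)) * (\<Prod>j\<in>A - {k}. (z k + z j) / (z k - z j))"
      by (simp add: c[OF k])
  qed
  ultimately have eq: "(1 - (-1) ^ m) * (\<Prod>j\<in>A. z j)
    = - (2 * (-1) ^ m * (\<Prod>j\<in>A. z j)) * (\<Sum>k\<in>A. \<Prod>j\<in>A - {k}. (z k + z j) / (z k - z j))"
    (is "?L * ?P = _ * ?S")
    by (simp only: sum_distrib_left)
  have "?P \<noteq> 0" using fin nz by (simp add: prod_zero_iff)
  moreover have "?P * ?L = ?P * (- (2 * (-1) ^ m) * ?S)"
    using eq by (simp only: mult.commute[of ?P ?L]) simp
  ultimately have "?L = - (2 * (-1) ^ m) * ?S" by (rule mult_left_cancel[THEN iffD1])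
  thus ?thesis using two by (cases "odd m") (auto simp: m_def[symmetric])
qed auto

text \<open>
  When the last exponent is 0, the variable in that place enters only through its ratios with the
  later ones.  Averaging over which of the \<open>n - l\<close> remaining variables takes that place produces the
  sum of \<open>sum_prod_ratio_parity\<close>.  This is where the parity of the number of variables enters, and why
  the limit is taken along even numbers.
\<close>

lemma P_sum_last_zero:
  fixes y :: "nat \<Rightarrow> 'a::field"
  assumes ln: "l < n" and a: "a l = 0" and inj: "inj_on y {..<n}"
    and nz: "\<And>i. i < n \<Longrightarrow> y i \<noteq> 0" and two: "(2::'a) \<noteq> 0"
  shows "of_nat (n - l) * P_sum (Suc l) a n y = (if odd (n - l) then P_sum l a n y else 0)"
proof -
  let ?g = "\<lambda>i j. (y i + y j) / (y i - y j)"
  define C where "C w = (\<Prod>i<l. y (w i) ^ a i) * (\<Prod>i<l. \<Prod>j\<in>{i<..<n}. ?g (w i) (w j))" for w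
  define F where "F w = C w * (\<Prod>j\<in>{l<..<n}. ?g (w l) (w j))" for w
  have PS: "P_sum (Suc l) a n y = (\<Sum>w | w permutes {..<n}. F w)"
    unfolding P_sum_def F_def C_def using a by (simp add: mult_ac)
  have F_swap: "F (w \<circ> transpose l k) = C w * (\<Prod>j\<in>{l..<n} - {k}. ?g (w k) (w j))"
    if k: "k \<in> {l..<n}" for w k
  proof -
    let ?t = "transpose l k"
    have t: "?t permutes {l..<n}" using k by (intro permutes_swap_id) auto
    have "(\<Prod>j\<in>{i<..<n}. ?g (w i) (w (?t j))) = (\<Prod>j\<in>{i<..<n}. ?g (w i) (w j))" if "i < l" for i
    proof -
      have "?t permutes {i<..<n}" by (rule permutes_subset[OF t]) (use that in auto)
      from prod.permute[OF this, of "\<lambda>j. ?g (w i) (w j)"] show ?thesis by (simp add: o_def)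
    qed
    moreover have "?t i = i" if "i < l" for i using permutes_not_in[OF t, of i] that by simp
    ultimately have "C (w \<circ> ?t) = C w" unfolding C_def by simp
    moreover have "(\<Prod>j\<in>{l<..<n}. ?g (w k) (w (?t j))) = (\<Prod>j\<in>{l..<n} - {k}. ?g (w k) (w j))"
    proof (rule prod.reindex_bij_betw)
      have "bij_betw ?t {l<..<n} (?t ` {l<..<n})"
        by (rule inj_on_imp_bij_betw[OF permutes_inj_on[OF t]])
      moreover have "?t ` ({l..<n} - {l}) = ?t ` {l..<n} - ?t ` {l}"
        by (rule image_set_diff) simp
      moreover have "{l..<n} - {l} = {l<..<n}" by auto
      moreover have "?t ` {l..<n} = {l..<n}" by (rule permutes_image[OF t])
      ultimately show "bij_betw ?t {l<..<n} ({l..<n} - {k})" by simp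
    qed
    ultimately show ?thesis unfolding F_def by simp
  qed
  have "of_nat (n - l) * P_sum (Suc l) a n y = (\<Sum>k\<in>{l..<n}. \<Sum>w | w permutes {..<n}. F w)"
    unfolding PS by simp
  also have "\<dots> = (\<Sum>k\<in>{l..<n}. \<Sum>w | w permutes {..<n}. F (w \<circ> transpose l k))"
  proof (rule sum.cong[OF refl])
    fix k assume "k \<in> {l..<n}"
    hence "transpose l k permutes {..<n}" using ln by (intro permutes_swap_id) auto
    from sum_permutations_compose_right[OF this, of F]
    show "(\<Sum>w | w permutes {..<n}. F w) = (\<Sum>w | w permutes {..<n}. F (w \<circ> transpose l k))" .
  qed
  also have "\<dots> = (\<Sum>w | w permutes {..<n}. \<Sum>k\<in>{l..<n}. F (w \<circ> transpose l k))"
    by (rule sum.swap)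
  also have "\<dots> = (\<Sum>w | w permutes {..<n}. C w * (if odd (n - l) then 1 else 0))"
  proof (rule sum.cong[OF refl])
    fix w assume "w \<in> {w. w permutes {..<n}}"
    hence w: "w permutes {..<n}" by simp
    have "w ` {l..<n} \<subseteq> w ` {..<n}" by (intro image_mono) auto
    hence "inj_on y (w ` {l..<n})" using inj_on_subset[OF inj] permutes_image[OF w] by simp
    hence "inj_on (y \<circ> w) {l..<n}" by (intro comp_inj_on permutes_inj_on[OF w])
    hence "inj_on (\<lambda>i. y (w i)) {l..<n}" unfolding o_def .
    moreover have "y (w k) \<noteq> 0" if "k \<in> {l..<n}" for k
      using nz[of "w k"] permutes_in_image[OF w, of k] that by simp
    ultimately have "(\<Sum>k\<in>{l..<n}. \<Prod>j\<in>{l..<n} - {k}. ?g (w k) (w j)) = (if odd (n - l) then 1 else 0)"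
      using sum_prod_ratio_parity[of "{l..<n}" "\<lambda>i. y (w i)"] two by simp
    thus "(\<Sum>k\<in>{l..<n}. F (w \<circ> transpose l k)) = C w * (if odd (n - l) then 1 else 0)"
      by (simp add: F_swap sum_distrib_left[symmetric] cong: sum.cong_simp)
  qed
  also have "\<dots> = (if odd (n - l) then P_sum l a n y else 0)"
    by (simp add: P_sum_def C_def)
  finally show ?thesis .
qed

section \<open>Sums of antisymmetric functions\<close>

text \<open>
  Sequences are padded with zeros, as partitions are, so that each element stands for its first \<open>l\<close>
  entries and is a strict partition of length \<open>l\<close> or \<open>l - 1\<close>.
\<close>

definition decreasing_seqs :: "nat \<Rightarrow> nat \<Rightarrow> (nat \<Rightarrow> nat) set" where
  "decreasing_seqs l N = {a. (\<forall>i j. i < j \<longrightarrow> j < l \<longrightarrow> a j < a i) \<and> (\<forall>i<l. a i \<le> N) \<and> (\<forall>i\<ge>l. a i = 0)}"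

lemma decreasing_seqsD: "a \<in> decreasing_seqs l N \<Longrightarrow> i < j \<Longrightarrow> j < l \<Longrightarrow> a j < a i"
  by (simp add: decreasing_seqs_def)

lemma decreasing_seq_inj:
  assumes "a \<in> decreasing_seqs l N"
  shows "inj_on a {..<l}"
proof (rule linorder_inj_onI)
  fix i j assume "i < j" "j \<in> {..<l}"
  thus "a i \<noteq> a j" using decreasing_seqsD[OF assms, of i j] by simp
qed auto

text \<open>
  The position of an entry is determined by the set of entries; this makes sorting unique.
\<close>

lemma decreasing_seq_rank:
  assumes a: "a \<in> decreasing_seqs l N" and i: "i < l"
  shows "card {x \<in> a ` {..<l}. a i < x} = i"
proof -
  have "{x \<in> a ` {..<l}. a i < x} = a ` {..<i}"
  proof (intro equalityI subsetI)
    fix x assume "x \<in> {x \<in> a ` {..<l}. a i < x}"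
    then obtain j where j: "j < l" "x = a j" "a i < a j" by auto
    have "j < i" using decreasing_seqsD[OF a, of i j] j by (cases i j rule: linorder_cases) auto
    thus "x \<in> a ` {..<i}" using j by simp
  qed (use a i in \<open>auto simp: decreasing_seqs_def\<close>)
  moreover have "card (a ` {..<i}) = i"
    using decreasing_seq_inj[OF a] i by (subst card_image) (auto intro: inj_on_subset)
  ultimately show ?thesis by simp
qed

lemma decreasing_seq_eqI:
  assumes a: "a \<in> decreasing_seqs l N" and b: "b \<in> decreasing_seqs l N" and img: "a ` {..<l} = b ` {..<l}"
  shows "a = b"
proof
  fix i
  show "a i = b i"
  proof (cases "i < l")
    case True
    hence "a i \<in> b ` {..<l}" using img by blast
    then obtain j where j: "j < l" "a i = b j" by auto
    have "i = j" using decreasing_seq_rank[OF a True] decreasing_seq_rank[OF b j(1)] img j by simp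
    thus ?thesis using j by simp
  qed (use a b in \<open>auto simp: decreasing_seqs_def\<close>)
qed

lemma ex_decreasing_seq:
  assumes S: "S \<subseteq> {..N}" "card S = l"
  shows "\<exists>a \<in> decreasing_seqs l N. a ` {..<l} = S"
proof -
  have fin: "finite S" using S finite_subset by blast
  define xs where "xs = rev (sorted_list_of_set S)"
  have len: "length xs = l" using S by (simp add: xs_def)
  have set: "set xs = S" using fin by (simp add: xs_def)
  have sorted: "sorted_wrt (>) xs" unfolding xs_def by (simp add: sorted_wrt_rev)
  let ?a = "\<lambda>i. if i < l then xs ! i else 0"
  have "?a ` {..<l} = S" using set len by (force simp: set_conv_nth)
  moreover have "?a \<in> decreasing_seqs l N"
    using sorted_wrt_nth_less[OF sorted] len set S nth_mem[of _ xs] by (auto simp: decreasing_seqs_def)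
  ultimately show ?thesis by blast
qed

text \<open>
  Sorting a tuple without repetitions: the set of its entries, listed downwards, gives the decreasing
  sequence, and the permutation records the rank of each entry.
\<close>

lemma bij_betw_sorting:
  "bij_betw (\<lambda>(a, s). restrict (\<lambda>i. a (s i)) {..<l}) (decreasing_seqs l N \<times> {s. s permutes {..<l}})
     {b \<in> {..<l} \<rightarrow>\<^sub>E {..N}. inj_on b {..<l}}"
  unfolding bij_betw_def
proof (intro conjI equalityI subsetI)
  let ?r = "\<lambda>(a, s). restrict (\<lambda>i. a (s i)) {..<l} :: nat \<Rightarrow> nat"
  have img: "?r (a, s) ` {..<l} = a ` {..<l}" if "s permutes {..<l}" for a s
  proof -
    have "?r (a, s) ` {..<l} = a ` s ` {..<l}" by (simp add: image_image)
    thus ?thesis by (simp only: permutes_image[OF that])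
  qed
  show "inj_on ?r (decreasing_seqs l N \<times> {s. s permutes {..<l}})"
  proof (rule inj_onI, clarify)
    fix a s b u assume a: "a \<in> decreasing_seqs l N" and s: "s permutes {..<l}"
      and b: "b \<in> decreasing_seqs l N" and u: "u permutes {..<l}"
      and eq: "restrict (\<lambda>i. a (s i)) {..<l} = restrict (\<lambda>i. b (u i)) {..<l}"
    have ab: "a = b" using img[OF s, of a] img[OF u, of b] eq by (intro decreasing_seq_eqI[OF a b]) simp
    have "s i = u i" for i
    proof (cases "i < l")
      case True
      have "a (s i) = a (u i)" using fun_cong[OF eq, of i] True ab by simp
      thus ?thesis using decreasing_seq_inj[OF a] True permutes_in_image[OF s] permutes_in_image[OF u]
        by (auto dest!: inj_onD)
    qed (use permutes_not_in[OF s] permutes_not_in[OF u] in auto)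
    thus "a = b \<and> s = u" using ab by auto
  qed
  fix b assume "b \<in> {b \<in> {..<l} \<rightarrow>\<^sub>E {..N}. inj_on b {..<l}}"
  hence b: "b \<in> {..<l} \<rightarrow>\<^sub>E {..N}" and inj: "inj_on b {..<l}" by auto
  have "b ` {..<l} \<subseteq> {..N}" using b by auto
  moreover have "card (b ` {..<l}) = l" using inj by (simp add: card_image)
  ultimately obtain a where a: "a \<in> decreasing_seqs l N" "a ` {..<l} = b ` {..<l}"
    using ex_decreasing_seq[of "b ` {..<l}" N l] by auto
  define s where "s i = (if i < l then inv_into {..<l} a (b i) else i)" for i
  have "bij_betw (\<lambda>i. inv_into {..<l} a (b i)) {..<l} {..<l}"
    using bij_betw_trans[of b "{..<l}" "b ` {..<l}" "inv_into {..<l} a" "{..<l}"] inj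
      bij_betw_inv_into[of a "{..<l}" "a ` {..<l}"] decreasing_seq_inj[OF a(1)] a(2)
    by (simp add: bij_betw_def o_def)
  hence "bij_betw s {..<l} {..<l}" by (rule bij_betw_cong[THEN iffD1, rotated]) (simp add: s_def)
  hence s: "s permutes {..<l}" by (rule bij_imp_permutes) (simp add: s_def)
  have "b = ?r (a, s)"
  proof
    fix i show "b i = ?r (a, s) i"
    proof (cases "i < l")
      case True
      hence "b i \<in> b ` {..<l}" by simp
      hence "a (inv_into {..<l} a (b i)) = b i" unfolding a(2)[symmetric] by (rule f_inv_into_f)
      thus ?thesis using True by (simp add: s_def)
    next
      case False
      thus ?thesis using PiE_arb[OF b, of i] by (simp add: restrict_def)
    qed
  qed
  thus "b \<in> ?r ` (decreasing_seqs l N \<times> {s. s permutes {..<l}})" using a s by blast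
next
  fix b assume "b \<in> (\<lambda>(a, s). restrict (\<lambda>i. a (s i)) {..<l}) ` (decreasing_seqs l N \<times> {s. s permutes {..<l}})"
  then obtain a s where a: "a \<in> decreasing_seqs l N" and s: "s permutes {..<l}"
    and b: "b = restrict (\<lambda>i. a (s i)) {..<l}" by auto
  have lt: "s i < l" if "i < l" for i using permutes_in_image[OF s, of i] that by simp
  have "inj_on a (s ` {..<l})" using decreasing_seq_inj[OF a] by (simp only: permutes_image[OF s])
  hence "inj_on (a \<circ> s) {..<l}" by (rule comp_inj_on[OF permutes_inj_on[OF s]])
  hence "inj_on b {..<l}" by (simp add: b inj_on_def)
  moreover have "a (s i) \<le> N" if "i < l" for i using a lt[OF that] by (simp add: decreasing_seqs_def)
  hence "b \<in> {..<l} \<rightarrow>\<^sub>E {..N}" unfolding b by (intro restrict_PiE_iff[THEN iffD2]) simp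
  ultimately show "b \<in> {b \<in> {..<l} \<rightarrow>\<^sub>E {..N}. inj_on b {..<l}}" by simp
qed

text \<open>
  A tuple with a repeated entry contributes nothing.  The others are grouped by the decreasing tuple
  with the same entries; in each group the signs turn the products of coefficients into the Leibniz
  expansion of a determinant.
\<close>

lemma sum_antisymmetric_eq_sum_det:
  fixes E :: "nat \<Rightarrow> nat \<Rightarrow> 'a::comm_ring_1" and Q :: "(nat \<Rightarrow> nat) \<Rightarrow> 'a"
  assumes local: "\<And>a b. (\<And>i. i < l \<Longrightarrow> a i = b i) \<Longrightarrow> Q a = Q b"
    and antisym: "\<And>a s. s permutes {..<l} \<Longrightarrow> Q (\<lambda>i. a (s i)) = of_int (sign s) * Q a"
    and collision: "\<And>a. \<not> inj_on a {..<l} \<Longrightarrow> Q a = 0"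
  shows "(\<Sum>b\<in>{..<l} \<rightarrow>\<^sub>E {..N}. (\<Prod>i<l. E i (b i)) * Q b)
    = (\<Sum>a\<in>decreasing_seqs l N. det (mat l l (\<lambda>(i, j). E i (a j))) * Q a)"
proof -
  have fin: "finite ({..<l} \<rightarrow>\<^sub>E {..N})" by (intro finite_PiE) auto
  have "(\<Sum>b\<in>{..<l} \<rightarrow>\<^sub>E {..N}. (\<Prod>i<l. E i (b i)) * Q b)
    = (\<Sum>b\<in>{b \<in> {..<l} \<rightarrow>\<^sub>E {..N}. inj_on b {..<l}}. (\<Prod>i<l. E i (b i)) * Q b)"
    by (rule sum.mono_neutral_right[OF fin]) (auto simp: collision)
  also have "\<dots> = (\<Sum>(a, s)\<in>decreasing_seqs l N \<times> {s. s permutes {..<l}}.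
      (\<Prod>i<l. E i (restrict (\<lambda>i. a (s i)) {..<l} i)) * Q (restrict (\<lambda>i. a (s i)) {..<l}))"
    by (subst sum.reindex_bij_betw[OF bij_betw_sorting, symmetric]) (simp add: case_prod_unfold)
  also have "\<dots> = (\<Sum>(a, s)\<in>decreasing_seqs l N \<times> {s. s permutes {..<l}}.
      of_int (sign s) * (\<Prod>i<l. E i (a (s i))) * Q a)"
  proof (rule sum.cong[OF refl], clarify)
    fix a s assume s: "s permutes {..<l}"
    have "Q (restrict (\<lambda>i. a (s i)) {..<l}) = Q (\<lambda>i. a (s i))" by (rule local) simp
    thus "(\<Prod>i<l. E i (restrict (\<lambda>i. a (s i)) {..<l} i)) * Q (restrict (\<lambda>i. a (s i)) {..<l})
      = of_int (sign s) * (\<Prod>i<l. E i (a (s i))) * Q a"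
      by (simp add: antisym[OF s] mult_ac)
  qed
  also have "\<dots> = (\<Sum>a\<in>decreasing_seqs l N. det (mat l l (\<lambda>(i, j). E i (a j))) * Q a)"
    unfolding sum.cartesian_product[symmetric] det_Leibniz sum_distrib_right by simp
  finally show ?thesis .
qed

section \<open>Integrality and stability\<close>

text \<open>
  Embedding into the field of fractions, including the coefficients and setting variables to zero are
  treated uniformly as ring homomorphisms.
\<close>

lemma (in comm_ring_hom) hom_vandermonde: "hom (vandermonde n y) = vandermonde n (\<lambda>i. hom (y i))"
  by (simp add: vandermonde_def hom_distribs)

lemma (in comm_ring_hom) hom_P_alt: "hom (P_alt l a n y) = P_alt l a n (\<lambda>i. hom (y i))"
  by (simp add: P_alt_def hom_distribs)

interpretation frac: comm_ring_hom frac
  by unfold_locales (auto simp: frac_def One_fract_def Zero_fract_def)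

interpretation Const: comm_ring_hom Const
  by unfold_locales (auto simp: Const_def single_add mult_single)

lemma frac_eq_iff [simp]: "frac p = frac q \<longleftrightarrow> p = q"
  by (simp add: frac_def eq_fract)

lemma of_nat_fract_eq_0_iff: "(of_nat k :: xpoly fract) = 0 \<longleftrightarrow> k = 0"
  by (simp add: of_nat_fract Zero_fract_def eq_fract)

lemma lookup_trunc_vars:
  "Poly_Mapping.lookup (trunc_vars n p) a = (if Poly_Mapping.keys a \<subseteq> {..<n} then Poly_Mapping.lookup p a else 0)"
proof -
  have "finite {a \<in> Poly_Mapping.keys p. Poly_Mapping.keys a \<subseteq> {..<n}}" by simp
  thus ?thesis
    by (auto simp: trunc_vars_def lookup_sum lookup_single when_def sum.delta in_keys_iff)
qed

lemma trunc_vars_single: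
  "trunc_vars n (Poly_Mapping.single a c) = (if Poly_Mapping.keys a \<subseteq> {..<n} then Poly_Mapping.single a c else 0)"
  by (intro poly_mapping_eqI) (auto simp: lookup_trunc_vars lookup_single when_def)

lemma trunc_vars_add: "trunc_vars n (p + q) = trunc_vars n p + trunc_vars n q"
  by (intro poly_mapping_eqI) (auto simp: lookup_trunc_vars lookup_add)

lemma trunc_vars_zero: "trunc_vars n 0 = 0"
  by (simp add: trunc_vars_def)

lemma trunc_vars_sum: "trunc_vars n (sum f A) = (\<Sum>i\<in>A. trunc_vars n (f i))"
  by (induction A rule: infinite_finite_induct) (auto simp: trunc_vars_zero trunc_vars_add)

lemma poly_mapping_eq_sum_single:
  "p = (\<Sum>a\<in>Poly_Mapping.keys p. Poly_Mapping.single a (Poly_Mapping.lookup p a))"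
  by (intro poly_mapping_eqI) (auto simp: lookup_sum lookup_single when_def sum.delta in_keys_iff)

lemma keys_plus_nat: "Poly_Mapping.keys (a + b) = Poly_Mapping.keys a \<union> Poly_Mapping.keys (b :: nat \<Rightarrow>\<^sub>0 nat)"
  by (auto simp: in_keys_iff lookup_add)

lemma trunc_vars_mult: "trunc_vars n (p * q) = trunc_vars n p * trunc_vars n q"
proof -
  let ?m = "\<lambda>p a. Poly_Mapping.single a (Poly_Mapping.lookup p a) :: xpoly"
  let ?K = "Poly_Mapping.keys"
  have "p * q = (\<Sum>a\<in>?K p. \<Sum>b\<in>?K q. ?m p a * ?m q b)"
    by (subst poly_mapping_eq_sum_single[of p], subst poly_mapping_eq_sum_single[of q]) (rule sum_product)
  hence "trunc_vars n (p * q) = (\<Sum>a\<in>?K p. \<Sum>b\<in>?K q. trunc_vars n (?m p a * ?m q b))"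
    by (simp only: trunc_vars_sum)
  also have "\<dots> = (\<Sum>a\<in>?K p. \<Sum>b\<in>?K q. trunc_vars n (?m p a) * trunc_vars n (?m q b))"
    by (intro sum.cong refl) (simp add: mult_single trunc_vars_single keys_plus_nat)
  also have "\<dots> = trunc_vars n (\<Sum>a\<in>?K p. ?m p a) * trunc_vars n (\<Sum>b\<in>?K q. ?m q b)"
    by (simp only: trunc_vars_sum sum_product)
  finally show ?thesis by (simp only: poly_mapping_eq_sum_single[symmetric])
qed

interpretation trunc: comm_ring_hom "trunc_vars n" for n
proof unfold_locales
  show "trunc_vars n 1 = 1" using trunc_vars_single[of n 0 1] by simp
qed (auto simp: trunc_vars_zero trunc_vars_add trunc_vars_mult)

lemma trunc_vars_Const [simp]: "trunc_vars n (Const c) = Const c"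
  by (simp add: Const_def trunc_vars_single)

lemma trunc_vars_X [simp]: "trunc_vars n (X i) = (if i < n then X i else 0)"
  by (simp add: X_def trunc_vars_single)

lemma trunc_vars_trunc_vars [simp]: "trunc_vars n (trunc_vars m p) = trunc_vars (min n m) p"
proof -
  have "{..<min n m} = {..<n} \<inter> {..<m}" by auto
  thus ?thesis by (intro poly_mapping_eqI) (simp add: lookup_trunc_vars)
qed

text \<open>
  Turns both conditions in \<open>even_limit\<close> into equations between truncations, which homomorphism laws
  can handle.
\<close>

lemma trunc_vars_eq_iff: "trunc_vars n p = p \<longleftrightarrow> (\<forall>a\<in>Poly_Mapping.keys p. Poly_Mapping.keys a \<subseteq> {..<n})"
  by (auto simp: poly_mapping_eq_iff fun_eq_iff lookup_trunc_vars in_keys_iff split: if_splits)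

lemma inj_X: "X i = X j \<longleftrightarrow> i = j"
proof
  assume "X i = X j"
  hence "Poly_Mapping.keys (X i) = Poly_Mapping.keys (X j)" by simp
  hence "Poly_Mapping.single i (1::nat) = Poly_Mapping.single j 1" by (simp add: X_def)
  hence "Poly_Mapping.keys (Poly_Mapping.single i (1::nat)) = Poly_Mapping.keys (Poly_Mapping.single j (1::nat))" by simp
  thus "i = j" by simp
qed simp

lemma X_neq_0: "X i \<noteq> 0"
proof
  assume "X i = 0"
  hence "Poly_Mapping.keys (X i) = {}" by simp
  thus False by (simp add: X_def)
qed

lemma vandermonde_X_neq_0: "vandermonde n X \<noteq> 0"
  by (auto simp: vandermonde_def inj_X)

text \<open>
  The polynomial \<open>P_sum / (n - l)!\<close> in the variables \<open>X\<close>.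
\<close>

definition P_poly :: "nat \<Rightarrow> (nat \<Rightarrow> nat) \<Rightarrow> nat \<Rightarrow> xpoly" where
  "P_poly l a n = (SOME p. P_alt l a n X = vandermonde n X * p)"

lemma vandermonde_mult_P_poly:
  assumes "l \<le> n"
  shows "vandermonde n X * P_poly l a n = P_alt l a n X"
proof -
  have "\<exists>p. P_alt l a n X = vandermonde n X * p"
    using vandermonde_dvd_P_alt[OF assms] by (simp add: dvd_def)
  from someI_ex[OF this] show ?thesis by (simp add: P_poly_def)
qed

lemma frac_P_poly:
  assumes "l \<le> n"
  shows "of_nat (fact (n - l)) * frac (P_poly l a n) = P_sum l a n (\<lambda>i. frac (X i))"
proof -
  let ?y = "\<lambda>i. frac (X i)"
  have "inj_on ?y {..<n}" by (auto simp: inj_on_def inj_X)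
  hence "vandermonde n ?y * P_sum l a n ?y = of_nat (fact (n - l)) * P_alt l a n ?y"
    by (rule vandermonde_mult_P_sum[OF assms])
  also have "P_alt l a n ?y = frac (vandermonde n X * P_poly l a n)"
    by (simp only: vandermonde_mult_P_poly[OF assms] frac.hom_P_alt)
  also have "\<dots> = vandermonde n ?y * frac (P_poly l a n)"
    by (simp only: frac.hom_mult frac.hom_vandermonde)
  finally have "vandermonde n ?y * P_sum l a n ?y
    = vandermonde n ?y * (of_nat (fact (n - l)) * frac (P_poly l a n))" by (simp only: mult.left_commute)
  moreover have "vandermonde n ?y \<noteq> 0"
    using vandermonde_X_neq_0[of n] frac_eq_iff[of "vandermonde n X" 0]
    by (simp only: frac.hom_vandermonde frac.hom_zero) simp
  ultimately show ?thesis by simp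
qed

text \<open>
  Identities between symmetrisations over the field of fractions descend to the polynomials.  The two
  factorials are cross-multiplied so that different lengths \<open>l\<close> and \<open>k\<close> can be compared.
\<close>

lemma P_poly_eqI:
  assumes "l \<le> n" "k \<le> n"
    and "of_nat (fact (n - k)) * P_sum l a n (\<lambda>i. frac (X i)) = frac c * (of_nat (fact (n - l)) * P_sum k b n (\<lambda>i. frac (X i)))"
  shows "P_poly l a n = c * P_poly k b n"
proof -
  have "of_nat (fact (n - k) * fact (n - l)) * frac (P_poly l a n)
      = of_nat (fact (n - k) * fact (n - l)) * frac (c * P_poly k b n)"
    using assms(3) unfolding frac_P_poly[OF assms(1), symmetric] frac_P_poly[OF assms(2), symmetric]
    by (simp add: frac.hom_mult mult_ac)
  moreover have "(of_nat (fact (n - k) * fact (n - l)) :: xpoly fract) \<noteq> 0"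
    unfolding of_nat_fract_eq_0_iff by simp
  ultimately have "frac (P_poly l a n) = frac (c * P_poly k b n)" by (rule mult_left_cancel[THEN iffD1, rotated])
  thus ?thesis by (simp only: frac_eq_iff)
qed

lemma P_poly_cong:
  assumes "l \<le> n" "\<And>i. i < l \<Longrightarrow> a i = b i"
  shows "P_poly l a n = P_poly l b n"
proof -
  have "P_sum l a n (\<lambda>i. frac (X i)) = P_sum l b n (\<lambda>i. frac (X i))"
    by (rule P_sum_cong) (rule assms(2))
  thus ?thesis using P_poly_eqI[of l n l a 1 b] assms(1) by simp
qed

lemma P_poly_antisym:
  assumes "l \<le> n" "s permutes {..<l}"
  shows "P_poly l (\<lambda>i. a (s i)) n = of_int (sign s) * P_poly l a n"
  by (rule P_poly_eqI) (use assms in \<open>simp_all add: P_sum_antisym mult_ac frac.hom_of_int\<close>)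

lemma two_neq_0: "(2 :: xpoly fract) \<noteq> 0"
  using of_nat_fract_eq_0_iff[of 2] by simp

lemma P_poly_not_inj:
  assumes "l \<le> n" "\<not> inj_on a {..<l}"
  shows "P_poly l a n = 0"
  using P_poly_eqI[of l n l a 0 a] assms P_sum_not_inj[OF assms(1) two_neq_0 assms(2)] by simp

text \<open>
  The factor \<open>n - l\<close> in \<open>P_sum_last_zero\<close> is the quotient of the factorials \<open>(n - l)!\<close> and
  \<open>(n - l - 1)!\<close> attached to the lengths \<open>l\<close> and \<open>l + 1\<close>.
\<close>

lemma P_poly_last_zero:
  assumes "l < n" "a l = 0"
  shows "P_poly (Suc l) a n = (if odd (n - l) then P_poly l a n else 0)"
proof -
  let ?y = "\<lambda>i. frac (X i)"
  have y: "inj_on ?y {..<n}" "\<And>i. i < n \<Longrightarrow> ?y i \<noteq> 0"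
    using frac_eq_iff[of "X _" 0] by (auto simp: inj_on_def inj_X X_neq_0)
  have "n - l = Suc (n - Suc l)" using assms by simp
  hence "(fact (n - l) :: nat) = fact (n - Suc l) * (n - l)" by (metis fact_Suc mult.commute of_nat_id)
  hence "of_nat (fact (n - l)) * P_sum (Suc l) a n ?y
    = of_nat (fact (n - Suc l)) * (of_nat (n - l) * P_sum (Suc l) a n ?y)" by simp
  also have "of_nat (n - l) * P_sum (Suc l) a n ?y = (if odd (n - l) then P_sum l a n ?y else 0)"
    by (rule P_sum_last_zero) (use assms y two_neq_0 in auto)
  finally have "P_poly (Suc l) a n = (if odd (n - l) then 1 else 0) * P_poly l a n"
    by (intro P_poly_eqI) (use assms in auto)
  thus ?thesis by simp
qed

lemma vandermonde_Suc_zero: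
  assumes "y n = 0"
  shows "vandermonde (Suc n) y = vandermonde n y * (\<Prod>i<n. y i)"
proof -
  have "(\<Prod>j\<in>{i<..<Suc n}. y i - y j) = (\<Prod>j\<in>{i<..<n}. y i - y j) * y i" if "i < n" for i
  proof -
    have "{i<..<Suc n} = insert n {i<..<n}" using that by auto
    thus ?thesis using assms by (simp add: mult.commute)
  qed
  moreover have "{n<..<Suc n} = {}" by auto
  ultimately show ?thesis by (simp add: vandermonde_def prod.distrib cong: prod.cong_simp)
qed

text \<open>
  In \<open>n + 1\<close> variables the exponent is positive in every place except the last, so a summand survives
  at \<open>y n = 0\<close> only if its permutation keeps \<open>n\<close> in that place.  What remains is the numerator in
  \<open>n\<close> variables with one extra factor for each variable: from the ratio with \<open>y n\<close> in the first
  \<open>l\<close> places, and from the exponent \<open>n - i\<close> instead of \<open>n - 1 - i\<close> in the others.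
\<close>

lemma P_alt_Suc_zero:
  fixes y :: "nat \<Rightarrow> 'a::comm_ring_1"
  assumes l: "l \<le> n" and pos: "\<And>i. i < l \<Longrightarrow> a i > 0" and y: "y n = 0"
  shows "P_alt l a (Suc n) y = P_alt l a n y * (\<Prod>i<n. y i)"
proof -
  let ?F = "\<lambda>w. of_int (sign w) * ((\<Prod>i<l. y (w i) ^ a i) * (\<Prod>i\<in>{l..<Suc n}. y (w i) ^ (Suc n - 1 - i)) *
      (\<Prod>i<l. \<Prod>j\<in>{i<..<Suc n}. y (w i) + y (w j)))"
  let ?G = "\<lambda>w. of_int (sign w) * ((\<Prod>i<l. y (w i) ^ a i) * (\<Prod>i\<in>{l..<n}. y (w i) ^ (n - 1 - i)) *
      (\<Prod>i<l. \<Prod>j\<in>{i<..<n}. y (w i) + y (w j)))"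
  have sub: "{w. w permutes {..<n}} \<subseteq> {w. w permutes {..<Suc n}}" by (auto intro: permutes_subset)
  have "P_alt l a (Suc n) y = sum ?F {w. w permutes {..<Suc n}}" by (simp add: P_alt_def)
  also have "\<dots> = sum ?F {w. w permutes {..<n}}"
  proof (rule sum.mono_neutral_right[OF _ sub])
    show "\<forall>w\<in>{w. w permutes {..<Suc n}} - {w. w permutes {..<n}}. ?F w = 0"
    proof
      fix w assume "w \<in> {w. w permutes {..<Suc n}} - {w. w permutes {..<n}}"
      hence w: "w permutes {..<Suc n}" "\<not> w permutes {..<n}" by auto
      have "w n \<noteq> n"
      proof
        assume "w n = n"
        hence "w permutes {..<n}" using permutes_superset[OF w(1), of "{..<n}"] by (auto simp: less_Suc_eq)
        thus False using w by simp
      qed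
      moreover obtain k where k: "w k = n" using permutes_surj[OF w(1)] by (metis surjD)
      ultimately have "k \<noteq> n" by auto
      moreover have "k < Suc n" using permutes_in_image[OF w(1), of k] k by simp
      ultimately have "k < n" by simp
      have "(\<Prod>i<l. y (w i) ^ a i) * (\<Prod>i\<in>{l..<Suc n}. y (w i) ^ (Suc n - 1 - i)) = 0"
      proof (cases "k < l")
        case True
        hence "(\<Prod>i<l. y (w i) ^ a i) = 0"
          using k y pos[OF True] by (intro prod_zero) (auto simp: zero_power intro!: bexI[of _ k])
        thus ?thesis by simp
      next
        case False
        hence "(\<Prod>i\<in>{l..<Suc n}. y (w i) ^ (Suc n - 1 - i)) = 0"
          using k y \<open>k < n\<close> by (intro prod_zero) (auto simp: zero_power intro!: bexI[of _ k])
        thus ?thesis by simp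
      qed
      thus "?F w = 0" by simp
    qed
  qed (simp add: finite_permutations)
  also have "\<dots> = (\<Sum>w | w permutes {..<n}. ?G w * (\<Prod>i<n. y i))"
  proof (rule sum.cong[OF refl])
    fix w assume "w \<in> {w. w permutes {..<n}}"
    hence w: "w permutes {..<n}" by simp
    have yn: "y (w n) = 0" using permutes_not_in[OF w, of n] y by simp
    have "(\<Prod>i\<in>{l..<Suc n}. y (w i) ^ (Suc n - 1 - i)) = (\<Prod>i\<in>{l..<n}. y (w i) ^ (n - i))"
      using l by (simp add: atLeastLessThanSuc)
    also have "\<dots> = (\<Prod>i\<in>{l..<n}. y (w i) ^ (n - 1 - i) * y (w i))"
    proof (rule prod.cong[OF refl])
      fix i assume "i \<in> {l..<n}"
      hence "n - i = Suc (n - 1 - i)" by auto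
      thus "y (w i) ^ (n - i) = y (w i) ^ (n - 1 - i) * y (w i)" by (simp add: mult.commute)
    qed
    finally have 1: "(\<Prod>i\<in>{l..<Suc n}. y (w i) ^ (Suc n - 1 - i))
      = (\<Prod>i\<in>{l..<n}. y (w i) ^ (n - 1 - i)) * (\<Prod>i\<in>{l..<n}. y (w i))" by (simp add: prod.distrib)
    have "(\<Prod>j\<in>{i<..<Suc n}. y (w i) + y (w j)) = (\<Prod>j\<in>{i<..<n}. y (w i) + y (w j)) * y (w i)" if "i < l" for i
    proof -
      have "{i<..<Suc n} = insert n {i<..<n}" using that l by auto
      thus ?thesis using yn by (simp add: mult.commute)
    qed
    hence 2: "(\<Prod>i<l. \<Prod>j\<in>{i<..<Suc n}. y (w i) + y (w j))
      = (\<Prod>i<l. \<Prod>j\<in>{i<..<n}. y (w i) + y (w j)) * (\<Prod>i<l. y (w i))"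
      by (simp add: prod.distrib cong: prod.cong_simp)
    have "(\<Prod>i<n. y i) = (\<Prod>i<n. y (w i))" using prod.permute[OF w, of y] by (simp add: o_def)
    also have "\<dots> = (\<Prod>i<l. y (w i)) * (\<Prod>i\<in>{l..<n}. y (w i))" by (rule prod_lessThan_split[OF l])
    finally show "?F w = ?G w * (\<Prod>i<n. y i)" unfolding 1 2 by (simp only: mult_ac)
  qed
  also have "\<dots> = P_alt l a n y * (\<Prod>i<n. y i)" by (simp add: P_alt_def sum_distrib_right)
  finally show ?thesis .
qed

lemma vandermonde_cong: "(\<And>i. i < n \<Longrightarrow> y i = z i) \<Longrightarrow> vandermonde n y = vandermonde n z"
  unfolding vandermonde_def by (intro prod.cong refl) auto

lemma P_alt_cong:
  assumes "l \<le> n" "\<And>i. i < n \<Longrightarrow> y i = z i"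
  shows "P_alt l a n y = P_alt l a n z"
proof -
  have "y (w i) = z (w i)" if "w permutes {..<n}" "i < n" for w i
    using permutes_in_image[OF that(1), of i] that assms(2)[of "w i"] by simp
  thus ?thesis unfolding P_alt_def
    by (intro sum.cong arg_cong2[of _ _ _ _ "(*)"] prod.cong refl) (use assms(1) in auto)
qed

lemma trunc_vars_P_poly:
  assumes "l \<le> n"
  shows "trunc_vars n (P_poly l a n) = P_poly l a n"
proof -
  have V: "trunc_vars n (vandermonde n X) = vandermonde n X"
    unfolding trunc.hom_vandermonde by (rule vandermonde_cong) simp
  have "trunc_vars n (P_alt l a n X) = P_alt l a n X"
    unfolding trunc.hom_P_alt by (rule P_alt_cong[OF assms]) simp
  hence "vandermonde n X * trunc_vars n (P_poly l a n) = vandermonde n X * P_poly l a n"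
    unfolding vandermonde_mult_P_poly[OF assms, symmetric] trunc.hom_mult V .
  thus ?thesis using vandermonde_X_neq_0 by simp
qed

text \<open>
  The extra factor \<open>\<Prod>i<n. X i\<close> appears in both the numerator and the Vandermonde product.  Truncating
  one variable at a time keeps the denominators nonzero; positivity of the exponents makes this
  work for every \<open>n\<close>, not only along even numbers.
\<close>

lemma trunc_vars_P_poly_Suc:
  assumes l: "l \<le> n" and pos: "\<And>i. i < l \<Longrightarrow> a i > 0"
  shows "trunc_vars n (P_poly l a (Suc n)) = P_poly l a n"
proof -
  let ?y = "\<lambda>i. trunc_vars n (X i)" and ?e = "\<Prod>i<n. X i"
  have e: "(\<Prod>i<n. ?y i) = ?e" by (intro prod.cong) auto
  have V: "trunc_vars n (vandermonde (Suc n) X) = vandermonde n X * ?e"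
    unfolding trunc.hom_vandermonde using vandermonde_Suc_zero[of ?y n] e vandermonde_cong[of n ?y X] by simp
  have "trunc_vars n (P_alt l a (Suc n) X) = P_alt l a n X * ?e"
    unfolding trunc.hom_P_alt using P_alt_Suc_zero[OF l pos, where y = ?y] e P_alt_cong[OF l, of ?y X] by simp
  moreover have "l \<le> Suc n" using l by simp
  ultimately have "(vandermonde n X * ?e) * trunc_vars n (P_poly l a (Suc n)) = (vandermonde n X * ?e) * P_poly l a n"
    using V by (simp only: vandermonde_mult_P_poly[OF \<open>l \<le> Suc n\<close>, symmetric] trunc.hom_mult
        vandermonde_mult_P_poly[OF l, symmetric] mult_ac)
  moreover have "vandermonde n X * ?e \<noteq> 0" using vandermonde_X_neq_0 X_neq_0 by simp
  ultimately show ?thesis by (rule mult_left_cancel[THEN iffD1, rotated])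
qed

lemma trunc_vars_P_poly_le:
  assumes l: "l \<le> n" and pos: "\<And>i. i < l \<Longrightarrow> a i > 0" and nm: "n \<le> m"
  shows "trunc_vars n (P_poly l a m) = P_poly l a n"
  using nm
proof (induction m rule: dec_induct)
  case base
  show ?case by (rule trunc_vars_P_poly[OF l])
next
  case (step m)
  have "trunc_vars n (P_poly l a (Suc m)) = trunc_vars n (trunc_vars m (P_poly l a (Suc m)))"
    using step by simp
  also have "\<dots> = P_poly l a n" using step l pos by (simp only: trunc_vars_P_poly_Suc order_trans)
  finally show ?case .
qed

section \<open>Expansion of the double functions\<close>

text \<open>
  The coefficients vanish for \<open>k > r\<close>, so a single bound \<open>N\<close> can serve for all parts of a partition.
\<close>

lemma shifted_power_expand:
  assumes "r \<le> N"
  shows "shifted_power x t r = (\<Sum>k\<le>N. Const (elem_sym (\<lambda>i. - t i) r (int r - int k)) * x ^ k)"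
proof -
  let ?c = "\<lambda>A. \<Prod>i\<in>A. Const (- t i)"
  let ?A = "\<lambda>k. {A \<in> Pow {..<r}. r - card A = k}"
  have fin: "finite (Pow {..<r})" by simp
  have card: "card A \<le> r" if "A \<in> Pow {..<r}" for A
    using card_mono[of "{..<r}" A] that by simp
  have "shifted_power x t r = (\<Prod>k<r. Const (- t k) + x)"
    by (simp add: shifted_power_def Const.hom_uminus)
  also have "\<dots> = (\<Sum>A\<in>Pow {..<r}. ?c A * x ^ (r - card A))"
    by (subst prod_add) (auto intro!: sum.cong simp: card_Diff_subset finite_subset)
  also have "\<dots> = (\<Sum>k\<le>N. \<Sum>A\<in>?A k. ?c A * x ^ (r - card A))"
    \<comment> \<open>Group the subsets by the exponent that they leave.\<close>
    by (rule sum.group[symmetric]) (use assms in auto)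
  also have "\<dots> = (\<Sum>k\<le>N. Const (elem_sym (\<lambda>i. - t i) r (int r - int k)) * x ^ k)"
  proof (rule sum.cong[OF refl])
    fix k
    have "Const (elem_sym (\<lambda>i. - t i) r (int r - int k)) = (\<Sum>A\<in>?A k. ?c A)"
    proof (cases "k \<le> r")
      case True
      hence "{A. A \<subseteq> {..<r} \<and> card A = nat (int r - int k)} = ?A k" using card by auto
      thus ?thesis using True by (simp add: elem_sym_def Const.hom_sum Const.hom_prod)
    next
      case False
      hence A: "?A k = {}" by auto
      show ?thesis unfolding A using False by (simp add: elem_sym_def)
    qed
    thus "(\<Sum>A\<in>?A k. ?c A * x ^ (r - card A)) = Const (elem_sym (\<lambda>i. - t i) r (int r - int k)) * x ^ k"
      by (simp add: sum_distrib_right)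
  qed
  finally show ?thesis .
qed

lemma double_P_eqI:
  assumes "double_P_rat lam t n = frac p"
  shows "double_P lam t n = p"
  unfolding double_P_def using assms by (intro the_equality) auto

lemma frac_eq_inverse_P_sum:
  assumes "l \<le> n"
  shows "inverse (of_nat (fact (n - l))) * P_sum l a n (\<lambda>i. frac (X i)) = frac (P_poly l a n)"
  unfolding frac_P_poly[OF assms, symmetric]
  by (simp add: of_nat_fract_eq_0_iff del: of_nat_fact)

lemma double_P_zero:
  assumes "plen a \<le> n"
  shows "double_P a (\<lambda>_. 0) n = P_poly (plen a) a n"
proof (rule double_P_eqI)
  have "shifted_power x (\<lambda>_. 0) r = x ^ r" for x r by (simp add: shifted_power_def)
  thus "double_P_rat a (\<lambda>_. 0) n = frac (P_poly (plen a) a n)"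
    unfolding frac_eq_inverse_P_sum[OF assms, symmetric] double_P_rat_def P_sum_def
    by (simp add: frac.hom_power frac.hom_add frac.hom_minus)
qed

lemma double_P_expand:
  fixes t :: "nat \<Rightarrow> tpoly"
  assumes l: "plen lam = l" "l \<le> n" and N: "\<And>i. i < l \<Longrightarrow> lam i \<le> N"
  defines "E \<equiv> \<lambda>i k. Const (elem_sym (\<lambda>i. - t i) (lam i) (int (lam i) - int k))"
  shows "double_P lam t n = (\<Sum>b\<in>{..<l} \<rightarrow>\<^sub>E {..N}. (\<Prod>i<l. E i (b i)) * P_poly l b n)"
proof (rule double_P_eqI)
  let ?F = "of_nat (fact (n - l)) :: xpoly fract" and ?B = "{..<l} \<rightarrow>\<^sub>E {..N}"
  let ?y = "\<lambda>i. frac (X i)"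
  let ?D = "\<lambda>w. \<Prod>i<l. \<Prod>j\<in>{i<..<n}. (?y (w i) + ?y (w j)) / (?y (w i) - ?y (w j))"
  have num: "(\<Prod>i<l. frac (shifted_power (X (w i)) t (lam i)))
    = (\<Sum>b\<in>?B. (\<Prod>i<l. frac (E i (b i))) * (\<Prod>i<l. ?y (w i) ^ b i))" for w
  proof -
    have "(\<Prod>i<l. frac (shifted_power (X (w i)) t (lam i))) = (\<Prod>i<l. \<Sum>k\<le>N. frac (E i k) * ?y (w i) ^ k)"
    proof (rule prod.cong[OF refl])
      fix i assume "i \<in> {..<l}"
      hence "shifted_power (X (w i)) t (lam i) = (\<Sum>k\<le>N. E i k * X (w i) ^ k)"
        unfolding E_def by (intro shifted_power_expand N) simp
      thus "frac (shifted_power (X (w i)) t (lam i)) = (\<Sum>k\<le>N. frac (E i k) * ?y (w i) ^ k)"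
        by (simp add: frac.hom_sum frac.hom_mult frac.hom_power)
    qed
    also have "\<dots> = (\<Sum>b\<in>?B. \<Prod>i<l. frac (E i (b i)) * ?y (w i) ^ b i)"
      by (rule prod_sum_PiE) auto
    finally show ?thesis by (simp add: prod.distrib)
  qed
  have "double_P_rat lam t n = inverse ?F * (\<Sum>w | w permutes {..<n}.
      (\<Sum>b\<in>?B. (\<Prod>i<l. frac (E i (b i))) * (\<Prod>i<l. ?y (w i) ^ b i)) * ?D w)"
    unfolding double_P_rat_def l(1) num by (simp add: frac.hom_add frac.hom_minus)
  also have "\<dots> = inverse ?F * (\<Sum>b\<in>?B. \<Sum>w | w permutes {..<n}.
      (\<Prod>i<l. frac (E i (b i))) * ((\<Prod>i<l. ?y (w i) ^ b i) * ?D w))"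
    unfolding sum_distrib_right by (subst sum.swap) (simp add: mult.assoc)
  also have "\<dots> = (\<Sum>b\<in>?B. (\<Prod>i<l. frac (E i (b i))) * (inverse ?F * P_sum l b n ?y))"
    unfolding P_sum_def sum_distrib_left by (simp only: mult.left_commute)
  also have "\<dots> = frac (\<Sum>b\<in>?B. (\<Prod>i<l. E i (b i)) * P_poly l b n)"
    by (simp only: frac_eq_inverse_P_sum[OF l(2)] frac.hom_sum frac.hom_mult frac.hom_prod)
  finally show "double_P_rat lam t n = frac (\<Sum>b\<in>?B. (\<Prod>i<l. E i (b i)) * P_poly l b n)" .
qed

text \<open>
  Expanding all factors \<open>(x | t)\<close> leaves a sum over exponent tuples, in which the polynomials
  \<open>P_poly l b n\<close> are antisymmetric in \<open>b\<close>.
\<close>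

lemma double_P_eq_sum_det:
  fixes t :: "nat \<Rightarrow> tpoly"
  assumes l: "plen lam = l" "l \<le> n" and N: "\<And>i. i < l \<Longrightarrow> lam i \<le> N"
  shows "double_P lam t n = (\<Sum>a\<in>decreasing_seqs l N.
    P_poly l a n * Const (det (mat l l (\<lambda>(i, j). elem_sym (\<lambda>k. - t k) (lam i) (int (lam i) - int (a j))))))"
proof -
  let ?e = "\<lambda>i k. elem_sym (\<lambda>k. - t k) (lam i) (int (lam i) - int k)"
  have "double_P lam t n = (\<Sum>b\<in>{..<l} \<rightarrow>\<^sub>E {..N}. (\<Prod>i<l. Const (?e i (b i))) * P_poly l b n)"
    by (rule double_P_expand[OF l N])
  also have "\<dots> = (\<Sum>a\<in>decreasing_seqs l N. det (mat l l (\<lambda>(i, j). Const (?e i (a j)))) * P_poly l a n)"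
    by (rule sum_antisymmetric_eq_sum_det) (auto intro: P_poly_cong P_poly_antisym P_poly_not_inj l(2))
  also have "\<dots> = (\<Sum>a\<in>decreasing_seqs l N. P_poly l a n * Const (det (mat l l (\<lambda>(i, j). ?e i (a j)))))"
    by (simp add: det_Leibniz Const.hom_sum Const.hom_mult Const.hom_prod Const.hom_of_int mult.commute)
  finally show ?thesis .
qed

text \<open>
  The zero block has \<open>l - k\<close> rows and \<open>k + 1\<close> columns, so by the pigeonhole principle every term of the
  Leibniz expansion meets it.
\<close>

lemma det_zero_block:
  fixes f :: "nat \<times> nat \<Rightarrow> 'a::comm_ring_1"
  assumes k: "k < l" and zero: "\<And>i j. k \<le> i \<Longrightarrow> i < l \<Longrightarrow> j \<le> k \<Longrightarrow> f (i, j) = 0"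
  shows "det (mat l l f) = 0"
  unfolding det_Leibniz
proof (rule sum.neutral, rule ballI)
  fix w assume "w \<in> {w. w permutes {..<l}}"
  hence w: "w permutes {..<l}" by simp
  have "\<exists>i\<in>{k..<l}. w i \<le> k"
  proof (rule ccontr)
    assume "\<not> ?thesis"
    moreover have "w i < l" if "i < l" for i using permutes_in_image[OF w, of i] that by simp
    ultimately have "w ` {k..<l} \<subseteq> {k<..<l}" by (auto simp: not_le)
    hence "card (w ` {k..<l}) \<le> card {k<..<l}" by (intro card_mono) auto
    moreover have "card (w ` {k..<l}) = card {k..<l}" by (rule card_image[OF permutes_inj_on[OF w]])
    ultimately show False using k by simp
  qed
  then obtain i where "k \<le> i" "i < l" "w i \<le> k" by auto
  hence "(\<Prod>i<l. f (i, w i)) = 0" using zero by (intro prod_zero) auto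
  thus "of_int (sign w) * (\<Prod>i<l. f (i, w i)) = 0" by simp
qed

lemma partition_support:
  assumes "is_partition p"
  shows "{i. p i \<noteq> 0} = {..<plen p}"
proof -
  have fin: "finite {i. p i \<noteq> 0}" and anti: "antimono p" using assms by (auto simp: is_partition_def)
  have down: "j \<in> {i. p i \<noteq> 0}" if "i \<in> {i. p i \<noteq> 0}" "j \<le> i" for i j
    using antimonoD[OF anti that(2)] that(1) by simp
  have "\<exists>m. {i. p i \<noteq> 0} = {..<m}"
  proof (cases "{i. p i \<noteq> 0} = {}")
    case False
    have "{i. p i \<noteq> 0} = {..<Suc (Max {i. p i \<noteq> 0})}"
    proof (rule Set.set_eqI)
      fix i
      show "i \<in> {i. p i \<noteq> 0} \<longleftrightarrow> i \<in> {..<Suc (Max {i. p i \<noteq> 0})}"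
        using Max_ge[OF fin, of i] down[OF Max_in[OF fin False], of i]
        by (simp only: lessThan_iff less_Suc_eq_le) blast
    qed
    thus ?thesis by blast
  qed auto
  then obtain m where "{i. p i \<noteq> 0} = {..<m}" by blast
  thus ?thesis by (simp add: plen_def)
qed

section \<open>Projective limits\<close>

lemma even_limitD:
  assumes "f \<in> even_limit"
  shows "trunc_vars (2 * m) (f m) = f m" "trunc_vars (2 * m) (f (Suc m)) = f m"
  using assms by (auto simp: even_limit_def trunc_vars_eq_iff)

lemma even_limitI:
  assumes "\<And>m. trunc_vars (2 * m) (f m) = f m" "\<And>m. trunc_vars (2 * m) (f (Suc m)) = f m"
  shows "f \<in> even_limit"
  using assms unfolding even_limit_def trunc_vars_eq_iff by blast

text \<open>
  Each component is the truncation of the next one, so the high components determine the rest.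
\<close>

lemma even_limit_eqI:
  assumes f: "f \<in> even_limit" and g: "g \<in> even_limit" and eq: "\<And>m. m \<ge> M \<Longrightarrow> f m = g m"
  shows "f = g"
proof
  fix m
  show "f m = g m"
  proof (induction "M - m" arbitrary: m)
    case (Suc d)
    hence "f (Suc m) = g (Suc m)" by simp
    thus ?case by (metis even_limitD(2)[OF f] even_limitD(2)[OF g])
  qed (use eq in simp)
qed

lemma double_P_lim_eqI:
  assumes f: "f \<in> even_limit" and eq: "\<And>m. plen lam \<le> 2 * m \<Longrightarrow> f m = double_P lam t (2 * m)"
  shows "double_P_lim lam t = f"
  unfolding double_P_lim_def
proof (rule the_equality)
  fix g assume g: "g \<in> even_limit \<and> (\<forall>m. plen lam \<le> 2 * m \<longrightarrow> g m = double_P lam t (2 * m))"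
  show "g = f" by (rule even_limit_eqI[of _ _ "plen lam"]) (use f eq g in auto)
qed (use assms in auto)

text \<open>
  The family is defined in every component, also below \<open>plen a\<close>, by truncating a polynomial in
  enough variables.
\<close>

lemma schur_P_lim_eq_P_poly:
  assumes pos: "\<And>i. i < plen a \<Longrightarrow> a i > 0"
  shows "schur_P_lim a \<in> even_limit"
    and "plen a \<le> 2 * m \<Longrightarrow> schur_P_lim a m = P_poly (plen a) a (2 * m)"
proof -
  let ?l = "plen a"
  let ?f = "\<lambda>m. trunc_vars (2 * m) (P_poly ?l a (2 * (m + ?l)))"
  have f_eq: "?f m = P_poly ?l a (2 * m)" if "?l \<le> 2 * m" for m
    by (rule trunc_vars_P_poly_le) (use that pos in auto)
  have f: "?f \<in> even_limit"
  proof (rule even_limitI)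
    fix m
    show "trunc_vars (2 * m) (?f m) = ?f m" by simp
    have "trunc_vars (2 * (m + ?l)) (P_poly ?l a (2 * (Suc m + ?l))) = P_poly ?l a (2 * (m + ?l))"
      by (rule trunc_vars_P_poly_le) (use pos in auto)
    hence "trunc_vars (2 * m) (trunc_vars (2 * (m + ?l)) (P_poly ?l a (2 * (Suc m + ?l)))) = ?f m" by simp
    thus "trunc_vars (2 * m) (?f (Suc m)) = ?f m" by simp
  qed
  have "schur_P_lim a = ?f"
    unfolding schur_P_lim_def by (rule double_P_lim_eqI[OF f]) (simp only: f_eq double_P_zero)
  thus "schur_P_lim a \<in> even_limit" "?l \<le> 2 * m \<Longrightarrow> schur_P_lim a m = P_poly ?l a (2 * m)"
    using f f_eq by simp_all
qed

section \<open>Strict partitions over a staircase\<close>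

text \<open>
  Integers that decrease strictly drop by at least one in each step.
\<close>

lemma decreasing_seq_lower_bound:
  assumes a: "a \<in> decreasing_seqs l N" and i: "i < l"
  shows "a (l - 1) + (l - 1 - i) \<le> a i"
  using i
proof (induction "l - 1 - i" arbitrary: i)
  case 0
  hence "i = l - 1" by simp
  thus ?case by simp
next
  case (Suc d)
  hence "Suc i < l" "d = l - 1 - Suc i" by auto
  hence "a (l - 1) + (l - 1 - Suc i) \<le> a (Suc i)" by (intro Suc.hyps(1))
  moreover have "a (Suc i) < a i" using decreasing_seqsD[OF a, of i "Suc i"] \<open>Suc i < l\<close> by simp
  ultimately show ?case using \<open>Suc i < l\<close> by simp
qed

lemma decreasing_seq_minus_staircase:
  assumes a: "a \<in> decreasing_seqs l N" and r: "r \<le> l" and ge: "\<And>i. i < l \<Longrightarrow> r - i \<le> a i"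
  shows "\<exists>nu. is_partition nu \<and> a = padd (staircase r) nu"
proof -
  let ?nu = "\<lambda>i. a i - (r - i)"
  have z: "a i = 0" if "i \<ge> l" for i using a that by (simp add: decreasing_seqs_def)
  have "?nu (Suc i) \<le> ?nu i" for i
  proof (cases "Suc i < l")
    case True
    thus ?thesis using decreasing_seqsD[OF a, of i "Suc i"] ge[of i] ge[of "Suc i"] by simp
  qed (use z in simp)
  hence "antimono ?nu" by (simp add: decseq_Suc_iff)
  moreover have "{i. ?nu i \<noteq> 0} \<subseteq> {..<l}" using z by (auto simp: not_less intro: leI dest: leD)
  hence "finite {i. ?nu i \<noteq> 0}" by (rule finite_subset) simp
  moreover have "a i = (r - i) + ?nu i" for i
    using ge[of i] z[of i] r by (cases "i < l") auto
  ultimately show ?thesis unfolding is_partition_def padd_def staircase_def by blast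
qed

lemma plen_decreasing_seq:
  assumes a: "a \<in> decreasing_seqs l N"
  shows "plen a = (if l > 0 \<and> a (l - 1) = 0 then l - 1 else l)" and "i < plen a \<Longrightarrow> a i > 0"
proof -
  have z: "a i = 0" if "i \<ge> l" for i using a that by (simp add: decreasing_seqs_def)
  define k where "k = (if l > 0 \<and> a (l - 1) = 0 then l - 1 else l)"
  have "a i \<noteq> 0 \<longleftrightarrow> i < k" for i
    using decreasing_seq_lower_bound[OF a, of i] z[of i] unfolding k_def
    by (cases "i < l"; cases "i = l - 1") auto
  hence *: "{i. a i \<noteq> 0} = {..<k}" by auto
  hence k: "plen a = k" by (simp add: plen_def)
  thus "plen a = (if l > 0 \<and> a (l - 1) = 0 then l - 1 else l)" by (simp only: k_def)
  show "a i > 0" if "i < plen a" using * that unfolding k by auto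
qed

text \<open>
  A decreasing sequence whose last entry is 0 has length \<open>l - 1\<close>.  For even \<open>l\<close> and \<open>n\<close> the number
  \<open>n - (l - 1)\<close> is odd, so the zero exponent can be dropped without changing the polynomial.
\<close>

lemma P_poly_plen:
  assumes a: "a \<in> decreasing_seqs l N" and "l \<le> n" "even n" "even l \<or> a (l - 1) \<noteq> 0"
  shows "P_poly l a n = P_poly (plen a) a n"
proof (cases "l > 0 \<and> a (l - 1) = 0")
  case True
  then obtain k where k: "l = Suc k" by (cases l) auto
  have "P_poly (Suc k) a n = (if odd (n - k) then P_poly k a n else 0)"
    by (rule P_poly_last_zero) (use True k assms in auto)
  moreover have "odd (n - k)" using True k assms by auto
  ultimately show ?thesis using True k plen_decreasing_seq(1)[OF a] by simp
next
  case False
  thus ?thesis using plen_decreasing_seq(1)[OF a] by auto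
qed

text \<open>
  In finitely many variables \<open>n = 2 m\<close> the sum of \<open>double_P_eq_sum_det\<close> runs over all decreasing
  sequences \<open>a\<close>.  Those with \<open>a k > lam k\<close> for some \<open>k\<close> have a determinant with a large zero block,
  and for odd \<open>l\<close> those ending in 0 have \<open>P_poly l a n = 0\<close> because \<open>n - (l - 1)\<close> is even.  All others
  are a staircase plus a partition contained in \<open>mu\<close>; the staircase starts at \<open>l\<close> or \<open>l - 1\<close>
  according to whether the last entry is forced to be positive.  Since the right-hand side is a
  combination of elements of \<open>even_limit\<close>, this also shows that the components of the left-hand side
  are compatible, so that the limit exists.
\<close>

lemma double_P_lim_eq_sum_schur_P_lim:
  assumes lam: "is_strict_partition lam" "plen lam = l"
    and mu: "is_partition mu" "lam = padd (staircase r) mu"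
    and r: "r = (if even l then l - 1 else l)"
  shows "double_P_lim lam t = (\<lambda>m. \<Sum>nu | is_partition nu \<and> (\<forall>i. nu i \<le> mu i).
           schur_P_lim (padd (staircase r) nu) m * Const (flagged_S lam mu nu (\<lambda>k. - t k)))"
    (is "_ = (\<lambda>m. \<Sum>nu\<in>?M. ?s nu m * Const (?S nu))")
proof -
  let ?N = "lam 0" and ?phi = "padd (staircase r)"
  have part: "is_partition lam" and anti: "antimono lam"
    using lam by (auto simp: is_strict_partition_def is_partition_def)
  have supp: "lam i \<noteq> 0 \<longleftrightarrow> i < l" for i using partition_support[OF part] lam(2) by blast
  have r_le: "r \<le> l" and r_ge: "l - 1 \<le> r" using r by auto
  have phi_dec: "?phi nu \<in> decreasing_seqs l ?N" and phi_le: "?phi nu i \<le> lam i" if nu: "nu \<in> ?M" for nu i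
  proof -
    show le: "?phi nu i \<le> lam i" for i using nu mu(2) by (simp add: padd_def)
    have "antimono nu" using nu by (simp add: is_partition_def)
    hence "?phi nu j < ?phi nu i" if "i < j" "j < l" for i j
      using antimonoD[of nu i j] that r_ge by (simp add: padd_def staircase_def)
    moreover have "?phi nu i \<le> ?N" for i using le[of i] antimonoD[OF anti, of 0 i] by simp
    moreover have "?phi nu i = 0" if "i \<ge> l" for i using le[of i] supp[of i] that by simp
    ultimately show "?phi nu \<in> decreasing_seqs l ?N" by (simp add: decreasing_seqs_def)
  qed
  have phi_cond: "even l \<or> ?phi nu (l - 1) \<noteq> 0" for nu
    using r by (cases l) (auto simp: padd_def staircase_def)
  have inj: "inj_on ?phi ?M" by (auto simp: inj_on_def padd_def fun_eq_iff)
  let ?d = "\<lambda>a. det (mat l l (\<lambda>(i, j). elem_sym (\<lambda>k. - t k) (lam i) (int (lam i) - int (a j))))"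
  have S: "?S nu = ?d (?phi nu)" for nu
  proof -
    have "int (lam i) - int (?phi nu j) = int (mu i) - int (nu j) + int j - int i" if "i < l" "j < l" for i j
      using that r_ge mu(2) by (simp add: padd_def staircase_def of_nat_diff)
    thus ?thesis unfolding flagged_S_def lam(2) by (intro arg_cong[of _ _ det] eq_matI) auto
  qed
  have fin: "finite (decreasing_seqs l ?N)"
  proof -
    have "decreasing_seqs l ?N \<subseteq> {f. \<forall>i. (i \<in> {..<l} \<longrightarrow> f i \<in> {..?N}) \<and> (i \<notin> {..<l} \<longrightarrow> f i = 0)}"
      by (auto simp: decreasing_seqs_def)
    thus ?thesis by (rule finite_subset) (intro finite_set_of_finite_funs; simp)
  qed
  have expansion: "double_P lam t (2 * m) = (\<Sum>nu\<in>?M. ?s nu m * Const (?S nu))" if m: "l \<le> 2 * m" for m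
  proof -
    let ?term = "\<lambda>a. P_poly l a (2 * m) * Const (?d a)"
    have "double_P lam t (2 * m) = sum ?term (decreasing_seqs l ?N)"
      by (rule double_P_eq_sum_det[OF lam(2) m]) (use antimonoD[OF anti] in simp)
    also have "\<dots> = sum ?term (?phi ` ?M)"
    proof (rule sum.mono_neutral_right[OF fin])
      show "?phi ` ?M \<subseteq> decreasing_seqs l ?N" using phi_dec by blast
      show "\<forall>a\<in>decreasing_seqs l ?N - ?phi ` ?M. ?term a = 0"
      proof
        fix a assume "a \<in> decreasing_seqs l ?N - ?phi ` ?M"
        hence a: "a \<in> decreasing_seqs l ?N" and not_phi: "a \<notin> ?phi ` ?M" by auto
        show "?term a = 0"
        proof (cases "odd l \<and> a (l - 1) = 0")
          case True
          then obtain k where k: "l = Suc k" "even k" by (cases l) auto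
          have "P_poly (Suc k) a (2 * m) = (if odd (2 * m - k) then P_poly k a (2 * m) else 0)"
            by (rule P_poly_last_zero) (use True k m in auto)
          thus ?thesis using k m by simp
        next
          case False
          have "r - i \<le> a i" if "i < l" for i
            using decreasing_seq_lower_bound[OF a that] False r that by (cases "even l") auto
          from decreasing_seq_minus_staircase[OF a r_le this]
          obtain nu where nu: "is_partition nu" "a = ?phi nu" by blast
          with not_phi obtain k where "\<not> nu k \<le> mu k" by blast
          hence lt: "lam k < a k" using nu mu(2) by (simp add: padd_def)
          hence k: "k < l" using a by (cases "k < l") (auto simp: decreasing_seqs_def)
          have "?d a = 0"
          proof (rule det_zero_block[OF k])
            fix i j assume ij: "k \<le> i" "i < l" "j \<le> k"
            have "lam i \<le> lam k" using antimonoD[OF anti] ij by simp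
            moreover have "a k \<le> a j" using decreasing_seqsD[OF a, of j k] ij k by (cases "j = k") auto
            ultimately have "int (lam i) - int (a j) < 0" using lt by simp
            thus "(case (i, j) of (i, j) \<Rightarrow> elem_sym (\<lambda>k. - t k) (lam i) (int (lam i) - int (a j))) = 0"
              by (simp add: elem_sym_def)
          qed
          thus ?thesis by simp
        qed
      qed
    qed
    also have "\<dots> = (\<Sum>nu\<in>?M. ?term (?phi nu))" by (simp add: sum.reindex[OF inj])
    also have "\<dots> = (\<Sum>nu\<in>?M. ?s nu m * Const (?S nu))"
    proof (rule sum.cong[OF refl])
      fix nu assume nu: "nu \<in> ?M"
      note dec = phi_dec[OF nu]
      have "plen (?phi nu) \<le> 2 * m" using plen_decreasing_seq(1)[OF dec] m by (auto split: if_splits)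
      hence "?s nu m = P_poly (plen (?phi nu)) (?phi nu) (2 * m)"
        by (intro schur_P_lim_eq_P_poly(2) plen_decreasing_seq(2)[OF dec])
      also have "\<dots> = P_poly l (?phi nu) (2 * m)"
        by (rule P_poly_plen[OF dec m _ phi_cond, symmetric]) simp
      finally show "?term (?phi nu) = ?s nu m * Const (?S nu)" by (simp add: S)
    qed
    finally show ?thesis .
  qed
  show ?thesis
  proof (rule double_P_lim_eqI)
    have s: "?s nu \<in> even_limit" if "nu \<in> ?M" for nu
      using schur_P_lim_eq_P_poly(1) plen_decreasing_seq(2)[OF phi_dec[OF that]] by blast
    show "(\<lambda>m. \<Sum>nu\<in>?M. ?s nu m * Const (?S nu)) \<in> even_limit"
      by (rule even_limitI; unfold trunc.hom_sum trunc.hom_mult trunc_vars_Const)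
         (intro sum.cong refl; simp only: even_limitD[OF s])+
  qed (use expansion lam(2) in simp)
qed

theorem proposition4p2:
  fixes lam :: "nat \<Rightarrow> nat" and l :: nat
  assumes "is_strict_partition lam" and "plen lam = l"
  shows
    "(\<forall>mu. even l \<and> is_partition mu \<and> lam = padd (staircase (l - 1)) mu \<longrightarrow>
        double_P_lim lam T =
          (\<lambda>m. \<Sum>nu | is_partition nu \<and> (\<forall>i. nu i \<le> mu i).
             schur_P_lim (padd (staircase (l - 1)) nu) m *
               Const (flagged_S lam mu nu (\<lambda>k. - T k)))) \<and>
     (\<forall>mu. odd l \<and> is_partition mu \<and> lam = padd (staircase l) mu \<longrightarrow>
        double_P_lim lam T =
          (\<lambda>m. \<Sum>nu | is_partition nu \<and> (\<forall>i. nu i \<le> mu i).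
             schur_P_lim (padd (staircase l) nu) m *
               Const (flagged_S lam mu nu (\<lambda>k. - T k))))"
proof (intro conjI allI impI; elim conjE)
  fix mu
  assume "even l" "is_partition mu" "lam = padd (staircase (l - 1)) mu"
  thus "double_P_lim lam T = (\<lambda>m. \<Sum>nu | is_partition nu \<and> (\<forall>i. nu i \<le> mu i).
      schur_P_lim (padd (staircase (l - 1)) nu) m * Const (flagged_S lam mu nu (\<lambda>k. - T k)))"
    by (intro double_P_lim_eq_sum_schur_P_lim[OF assms]) auto
next
  fix mu
  assume "odd l" "is_partition mu" "lam = padd (staircase l) mu"
  thus "double_P_lim lam T = (\<lambda>m. \<Sum>nu | is_partition nu \<and> (\<forall>i. nu i \<le> mu i).
      schur_P_lim (padd (staircase l) nu) m * Const (flagged_S lam mu nu (\<lambda>k. - T k)))"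
    by (intro double_P_lim_eq_sum_schur_P_lim[OF assms]) auto
qed

end
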